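(* The attracting periodic point in $I_-$ approaches $\frac12$ as $(a,b)$ approaches the left boundary of the hyperbolic component from inside of the hyperbolic component, and the attracting periodic point in $I_-$ approaches $0$ as $(a,b)$ approaches the right boundary of the hyperbolic component from inside of the hyperbolic component. In particular, $0$ and $\frac12$ become neutral periodic points of $f_{a,b}$ respectively at the right and left boundary of any hyperbolic component.
   Context: Let $\mathbb T=\mathbb R/\mathbb Z$, identified with $[0,1]$ with $0\sim 1$. For $(a,b)\in\mathbb R/\mathbb Z\times[0,1]$ define $f_{a,b}:\mathbb T\to\mathbb T$ by $f_{a,b}(x)=\left(2x+a+\frac b2 S(x)\right)\bmod 1$, where $S(x)=4x-1$ for $x\in[0,\frac12]$ and $S(x)=-4x+3$ for $x\in[\frac12,1)$. Write $I_-=[\frac12,1]$. Let $\mathcal H=\{(a,b)\in\mathbb R/\mathbb Z\times[0,1): f_{a,b}\text{ has an attracting cycle}\}$; for $(a,b)\in\mathcal H$ the attracting cycle is unique. A hyperbolic component is a connected component of $\mathcal H$. "The attracting periodic point in $I_-$" means the point of the attracting cycle of $f_{a,b}$ lying in $I_-$. "Left" and "right" boundary of a hyperbolic component refer to the horizontal direction of the parameter space, that is, the direction of decreasing, respectively increasing, $a$. A periodic point $x$ of period $n$ of a map $g:\mathbb T\to\mathbb T$ is neutral if $x$ is neither an attracting nor a repelling fixed point of $g^n$, in the sense of topological dynamics (the maps $f_{a,b}$ are not differentiable at $0$ and $\frac12$).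
   Formalization: The attracting cycle can have several points in I_-, so "the" point is replaced by a continuously chosen point of the cycle in I_-, possibly a different one for the left and the right boundary; boundary points are horizontal endpoints with b<1, so vertical tips are excluded. *)

theory Defs
  imports "HOL-Analysis.Analysis"
begin

section \<open>The circle as a quotient of the reals\<close>

quotient_type circle = real / "\<lambda>x y. x - y \<in> \<int>"
  morphisms rep_circle to_circle
proof (intro equivpI reflpI sympI transpI)
  show "x - x \<in> \<int>" for x :: real by simp
  show "y - x \<in> \<int>" if "x - y \<in> \<int>" for x y :: real
    using Ints_minus[OF that] by simp
  show "x - z \<in> \<int>" if "x - y \<in> \<int>" "y - z \<in> \<int>" for x y z :: real
    using Ints_add[OF that] by simp
qed

instantiation circle :: ab_group_add
begin
lift_definition zero_circle :: circle is "0 :: real" .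
lift_definition plus_circle :: "circle \<Rightarrow> circle \<Rightarrow> circle" is "(+) :: real \<Rightarrow> real \<Rightarrow> real"
  by (metis Ints_add add_diff_add)
lift_definition uminus_circle :: "circle \<Rightarrow> circle" is "uminus :: real \<Rightarrow> real"
  by (metis Ints_minus minus_diff_minus)
lift_definition minus_circle :: "circle \<Rightarrow> circle \<Rightarrow> circle" is "(-) :: real \<Rightarrow> real \<Rightarrow> real"
proof -
  fix x x' y y' :: real
  assume "x - x' \<in> \<int>" "y - y' \<in> \<int>"
  then have "(x - x') - (y - y') \<in> \<int>" by (rule Ints_diff)
  then show "x - y - (x' - y') \<in> \<int>" by (simp add: algebra_simps)
qed
instance by standard (transfer, simp)+
end

definition dist_Ints :: "real \<Rightarrow> real"
  where "dist_Ints x = \<bar>x - of_int (round x)\<bar>"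

lemma dist_Ints_le: "m \<in> \<int> \<Longrightarrow> dist_Ints x \<le> \<bar>x - m\<bar>"
  unfolding dist_Ints_def by (elim Ints_cases) (simp add: round_diff_minimal)

lemma dist_Ints_attained: "\<exists>m\<in>\<int>. dist_Ints x = \<bar>x - m\<bar>"
  unfolding dist_Ints_def by auto

lemma dist_Ints_cong:
  assumes "x - y \<in> \<int>" shows "dist_Ints x = dist_Ints y"
proof -
  have le: "dist_Ints u \<le> dist_Ints v" if uv: "u - v \<in> \<int>" for u v
  proof -
    obtain m where m: "m \<in> \<int>" "dist_Ints v = \<bar>v - m\<bar>" using dist_Ints_attained by blast
    have "dist_Ints u \<le> \<bar>u - (m + (u - v))\<bar>" using m(1) uv by (intro dist_Ints_le Ints_add)
    then show ?thesis using m(2) by simp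
  qed
  have "y - x \<in> \<int>" using Ints_minus[OF assms] by simp
  then show ?thesis using le assms by (meson order_antisym)
qed

lemma dist_Ints_eq_0: "dist_Ints x = 0 \<longleftrightarrow> x \<in> \<int>"
proof
  assume "dist_Ints x = 0"
  then have "x = of_int (round x)" by (simp add: dist_Ints_def)
  then show "x \<in> \<int>" by (metis Ints_of_int)
next
  assume "x \<in> \<int>"
  then show "dist_Ints x = 0" using dist_Ints_le[of x x] by (simp add: dist_Ints_def)
qed

lemma dist_Ints_triangle: "dist_Ints (x - y) \<le> dist_Ints (x - z) + dist_Ints (y - z)"
proof -
  obtain m where m: "m \<in> \<int>" "dist_Ints (x - z) = \<bar>x - z - m\<bar>" using dist_Ints_attained by blast
  obtain k where k: "k \<in> \<int>" "dist_Ints (y - z) = \<bar>y - z - k\<bar>" using dist_Ints_attained by blast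
  have "dist_Ints (x - y) \<le> \<bar>(x - y) - (m - k)\<bar>" using m(1) k(1) by (intro dist_Ints_le Ints_diff)
  then show ?thesis using m(2) k(2) by linarith
qed

instantiation circle :: metric_space
begin
lift_definition dist_circle :: "circle \<Rightarrow> circle \<Rightarrow> real" is "\<lambda>x y. dist_Ints (x - y)"
proof -
  fix x x' y y' :: real
  assume "x - x' \<in> \<int>" "y - y' \<in> \<int>"
  then have "(x - x') - (y - y') \<in> \<int>" by (rule Ints_diff)
  then show "dist_Ints (x - y) = dist_Ints (x' - y')"
    by (intro dist_Ints_cong) (simp add: algebra_simps)
qed
definition uniformity_circle :: "(circle \<times> circle) filter"
  where "uniformity_circle = (INF e\<in>{0<..}. principal {(x, y). dist x y < e})"
definition open_circle :: "circle set \<Rightarrow> bool"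
  where "open_circle U = (\<forall>x\<in>U. \<forall>\<^sub>F (x', y) in uniformity. x' = x \<longrightarrow> y \<in> U)"
instance
proof
  show "dist x y = 0 \<longleftrightarrow> x = y" for x y :: circle
    by transfer (rule dist_Ints_eq_0)
  show "dist x y \<le> dist x z + dist y z" for x y z :: circle
    by transfer (rule dist_Ints_triangle)
qed (simp_all only: uniformity_circle_def open_circle_def)
end

text \<open>The metric induces the quotient topology.\<close>

lemma open_circle_iff: "open S \<longleftrightarrow> open (to_circle -` S)"
proof
  have le: "dist (to_circle y) (to_circle x) \<le> dist y x" for x y
    using dist_Ints_le[of 0 "y - x"] by (simp add: dist_circle.abs_eq dist_real_def)
  assume "open S"
  then show "open (to_circle -` S)"
    unfolding open_dist using le by (metis (no_types, lifting) le_less_trans vimage_eq)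
next
  assume op: "open (to_circle -` S)"
  show "open S"
    unfolding open_dist
  proof
    fix p assume "p \<in> S"
    obtain x where p: "p = to_circle x" by (metis Quotient3_abs_rep Quotient3_circle)
    with \<open>p \<in> S\<close> op obtain e where "e > 0"
      and e: "\<And>y. dist y x < e \<Longrightarrow> to_circle y \<in> S"
      unfolding open_dist by (metis vimage_eq)
    have "q \<in> S" if q: "dist q p < e" for q
    proof -
      obtain y where y: "q = to_circle y" by (metis Quotient3_abs_rep Quotient3_circle)
      obtain m where m: "m \<in> \<int>" "dist_Ints (y - x) = \<bar>y - x - m\<bar>"
        using dist_Ints_attained by blast
      have "dist (y - m) x < e"
        using q m(2) by (simp add: p y dist_circle.abs_eq dist_real_def algebra_simps)
      moreover have "to_circle (y - m) = to_circle y"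
        using m(1) Ints_minus[OF m(1)] by (simp add: circle.abs_eq_iff)
      ultimately show ?thesis using e y by metis
    qed
    with \<open>e > 0\<close> show "\<exists>e>0. \<forall>q. dist q p < e \<longrightarrow> q \<in> S" by blast
  qed
qed

section \<open>The family of maps\<close>

definition S :: "real \<Rightarrow> real"
  where "S x = (if frac x \<le> 1/2 then 4 * frac x - 1 else - 4 * frac x + 3)"

lemma S_cong:
  assumes "x - y \<in> \<int>" shows "S x = S y"
proof -
  obtain m where "x - y = of_int m" using assms by (elim Ints_cases)
  then have "x = y + of_int m" by simp
  then have "frac x = frac y" by (simp add: frac_def)
  then show ?thesis by (simp add: S_def)
qed

lift_definition f :: "circle \<Rightarrow> real \<Rightarrow> circle \<Rightarrow> circle"
  is "\<lambda>a b x. 2 * x + a + b / 2 * S x"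
proof -
  fix a a' b x x' :: real
  assume *: "a - a' \<in> \<int>" "x - x' \<in> \<int>"
  then have "2 * (x - x') + (a - a') \<in> \<int>" by (intro Ints_add Ints_mult) auto
  then show "2 * x + a + b / 2 * S x - (2 * x' + a' + b / 2 * S x') \<in> \<int>"
    using S_cong[OF *(2)] by (simp add: algebra_simps)
qed

definition I_minus :: "circle set"
  where "I_minus = to_circle ` {1/2..1}"

section \<open>Attracting cycles and neutral periodic points\<close>

definition has_period :: "('a \<Rightarrow> 'a) \<Rightarrow> nat \<Rightarrow> 'a \<Rightarrow> bool"
  where "has_period g n x \<longleftrightarrow>
    n \<ge> 1 \<and> (g ^^ n) x = x \<and> (\<forall>m. 1 \<le> m \<and> m < n \<longrightarrow> (g ^^ m) x \<noteq> x)"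

text \<open>
  No differentiability is assumed: a fixed point is attracting if the iterates converge to it
  uniformly on a neighbourhood, and repelling if every other point of some neighbourhood
  eventually leaves that neighbourhood.
\<close>

definition attracting_fixed_point :: "('a::metric_space \<Rightarrow> 'a) \<Rightarrow> 'a \<Rightarrow> bool"
  where "attracting_fixed_point g p \<longleftrightarrow> g p = p \<and>
    (\<exists>V. open V \<and> p \<in> V \<and> uniform_limit V (\<lambda>k. g ^^ k) (\<lambda>_. p) sequentially)"

definition repelling_fixed_point :: "('a::metric_space \<Rightarrow> 'a) \<Rightarrow> 'a \<Rightarrow> bool"
  where "repelling_fixed_point g p \<longleftrightarrow> g p = p \<and>
    (\<exists>V. open V \<and> p \<in> V \<and> (\<forall>x\<in>V - {p}. \<exists>k. (g ^^ k) x \<notin> V))"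

definition attracting_cycle :: "('a::metric_space \<Rightarrow> 'a) \<Rightarrow> 'a set \<Rightarrow> bool"
  where "attracting_cycle g C \<longleftrightarrow> (\<exists>n x. has_period g n x \<and> C = (\<lambda>i. (g ^^ i) x) ` {..<n} \<and>
    (\<forall>y\<in>C. attracting_fixed_point (g ^^ n) y))"

definition neutral_periodic_point :: "('a::metric_space \<Rightarrow> 'a) \<Rightarrow> 'a \<Rightarrow> bool"
  where "neutral_periodic_point g x \<longleftrightarrow> (\<exists>n. has_period g n x \<and>
    \<not> attracting_fixed_point (g ^^ n) x \<and> \<not> repelling_fixed_point (g ^^ n) x)"

section \<open>Hyperbolic components\<close>

definition hyperbolic_params :: "(circle \<times> real) set"
  where "hyperbolic_params = {(a, b). 0 \<le> b \<and> b < 1 \<and> (\<exists>C. attracting_cycle (f a b) C)}"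

text \<open>
  A boundary point is on the left if, on the horizontal line through it, the component lies
  immediately to its right. The extremal points of a component in the vertical direction, where
  the horizontal slice is empty, are neither on the left nor on the right.
\<close>

definition left_boundary :: "(circle \<times> real) set \<Rightarrow> (circle \<times> real) set"
  where "left_boundary U =
    {(a, b). (a, b) \<in> frontier U \<and> (\<forall>\<^sub>F t in at_right 0. (a + to_circle t, b) \<in> U)}"

definition right_boundary :: "(circle \<times> real) set \<Rightarrow> (circle \<times> real) set"
  where "right_boundary U =
    {(a, b). (a, b) \<in> frontier U \<and> (\<forall>\<^sub>F t in at_right 0. (a - to_circle t, b) \<in> U)}"

text \<open>
  The attracting cycle may meet \<open>I_minus\<close> in more than one point: for \<open>b = 3/4\<close> and \<open>a\<close> in
  \<open>(-19/40, -49/104)\<close> there is an attracting cycle of period 3 with two points in \<open>I_minus\<close>,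
  only one of which tends to \<open>1/2\<close> at the left end and only the other one to \<open>0\<close> at the right
  end. Therefore a point of the cycle in \<open>I_minus\<close> is followed continuously over the component.
\<close>

definition attracting_branch :: "(circle \<times> real) set \<Rightarrow> (circle \<times> real \<Rightarrow> circle) \<Rightarrow> bool"
  where "attracting_branch U p \<longleftrightarrow> continuous_on U p \<and>
    (\<forall>(a, b)\<in>U. \<exists>C. attracting_cycle (f a b) C \<and> p (a, b) \<in> C \<inter> I_minus)"

end

theory Submission imports Defs begin

text \<open>
  The circle map lifts to an increasing, piecewise linear map \<open>F\<close> of the line with slope \<open>2 + 2b\<close>
  on \<open>[0, 1/2]\<close> and \<open>2 - 2b\<close> on \<open>[1/2, 1]\<close>, modulo 1, and a monotone map \<open>semiconj\<close> of degree one
  semiconjugates \<open>F\<close> to doubling. A point \<open>p\<close> of an attracting cycle of period \<open>n\<close> lies in a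
  nondegenerate fibre of \<open>semiconj\<close>, over a point \<open>\<theta>\<close> of exact period \<open>n\<close> under doubling, and this
  fibre is an interval that the return map \<open>G x = F\<^sup>n x - (2\<^sup>n - 1) \<theta>\<close> maps onto itself. The first
  \<open>n\<close> images of the fibre are disjoint modulo 1, being fibres over distinct points. Hence the orbit
  of the fibre passes over each of the two kinks \<open>1/2\<close> and \<open>0\<close> of the circle map at most once
  (\<open>fiber_hits_once\<close>): on the fibre, \<open>G\<close> has at most one kink where its slope drops, coming from
  \<open>1/2\<close>, and at most one where it rises, coming from \<open>0\<close>.

  Now \<open>G\<close> fixes a point of the fibre on either side of \<open>p\<close>, while near \<open>p\<close> its graph crosses the
  diagonal downwards. So \<open>G\<close> cannot be convex on the left of \<open>p\<close> nor concave on the right of it: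
  the dropping kink lies to the left and the rising kink to the right. Moving along the cycle, the
  dropping kink may be placed at \<open>1/2\<close> itself. Then \<open>1/2 < p < 1\<close>, \<open>G (1/2) > 1/2\<close>, and \<open>G v < v\<close>
  for some \<open>v\<close> in \<open>(1/2, 1]\<close> (\<open>tongue_if_attracting_cycle\<close>). Conversely these two inequalities
  force \<open>G\<close> to be convex on \<open>[1/2, v]\<close>, so that it has exactly one fixed point there, which is
  attracting and is the limit of the orbit of \<open>1/2\<close> (\<open>unique_crossing\<close>). The inequalities are open in
  the parameters, and \<open>\<theta> = semiconj (1/2)\<close> determines \<open>n\<close>; therefore the hyperbolic parameters form
  an open set and \<open>n\<close> is constant on each component.

  Increasing \<open>a\<close> raises \<open>F\<close>. If a component lies immediately to the right of a parameter on its
  frontier, then \<open>G v < v\<close> still holds at that parameter and \<open>G (1/2) \<ge> 1/2\<close>; strict inequality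
  would make the parameter hyperbolic, which a frontier point of a component is not. So
  \<open>G (1/2) = 1/2\<close> (\<open>left_boundary_tangency\<close>). By convexity \<open>G x < x\<close> for \<open>x\<close> just to the right of
  \<open>1/2\<close>, which makes \<open>1/2\<close> not repelling; it is not attracting because the parameter is not
  hyperbolic. The inequality \<open>G x < x\<close> persists for nearby parameters of the component, and there it
  confines the attracting point between \<open>1/2\<close> and \<open>x\<close>. The right boundary follows from the left one
  by the reflection \<open>x \<mapsto> 1/2 - x\<close>, which conjugates the map with parameters \<open>(a, b)\<close> to the map
  with parameters \<open>(1/2 - a, b)\<close> and exchanges \<open>0\<close> and \<open>1/2\<close>.
\<close>

section \<open>Distances on the circle and on the line\<close>

lemma dist_Ints_small: assumes "\<bar>x\<bar> < 1/2" shows "dist_Ints x = \<bar>x\<bar>"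
proof -
  have "round x = 0" using assms by (intro round_unique') simp
  then show ?thesis by (simp add: dist_Ints_def)
qed

lemma dist_Ints_half: "\<bar>x\<bar> = 1/2 \<Longrightarrow> dist_Ints x = 1/2"
proof -
  assume "\<bar>x\<bar> = 1/2"
  then consider "x = 1/2" | "x = -(1/2)" by linarith
  moreover have "dist_Ints (1/2) = 1/2" "dist_Ints (-(1/2)) = 1/2"
    by (simp_all add: dist_Ints_def round_def)
  ultimately show "dist_Ints x = 1/2" by cases (simp_all only:)
qed

lemma to_circle_eq_iff: "to_circle x = to_circle y \<longleftrightarrow> x - y \<in> \<int>"
  by (simp add: circle.abs_eq_iff)

lemma to_circle_exhaust: obtains x where "c = to_circle x"
  by (metis Quotient3_abs_rep Quotient3_circle)

lemma dist_to_circle: "dist (to_circle x) (to_circle y) = dist_Ints (x - y)"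
  by (simp add: dist_circle.abs_eq)

lemma dist_to_circle_le: "dist (to_circle x) (to_circle y) \<le> \<bar>x - y\<bar>"
  using dist_Ints_le[of 0 "x - y"] by (simp add: dist_to_circle)

lemma nearest_lift: obtains y where "c = to_circle y" "\<bar>y - x\<bar> = dist c (to_circle x)"
proof -
  obtain z where z: "c = to_circle z" by (rule to_circle_exhaust)
  obtain m where m: "m \<in> \<int>" "dist_Ints (z - x) = \<bar>z - x - m\<bar>"
    using dist_Ints_attained by blast
  have "c = to_circle (z - m)" using m(1) by (simp add: z to_circle_eq_iff)
  moreover have "\<bar>z - m - x\<bar> = dist c (to_circle x)"
    using m(2) by (simp add: z dist_to_circle algebra_simps)
  ultimately show ?thesis by (rule that)
qed

lemma continuous_to_circle: "continuous_on A to_circle"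
proof -
  have "isCont to_circle x" for x
    unfolding continuous_at_eps_delta
    using dist_to_circle_le by (auto simp: dist_real_def intro: le_less_trans)
  then show ?thesis by (simp add: continuous_at_imp_continuous_on)
qed

lemma open_to_circle_image: assumes "open A" shows "open (to_circle ` A)"
proof -
  have "to_circle -` to_circle ` A = (\<Union>j\<in>\<int>. (+) j ` A)"
    by (auto simp: to_circle_eq_iff image_iff intro: Ints_minus) (metis add_diff_cancel_left' diff_add_cancel)+
  moreover have "open (\<Union>j\<in>\<int>. (+) j ` A)" using assms by (auto intro: open_translation)
  ultimately show ?thesis by (simp add: open_circle_iff)
qed

section \<open>The lift\<close>

definition F :: "real \<Rightarrow> real \<Rightarrow> real \<Rightarrow> real"
  where "F a b x = 2 * x + a + b / 2 * S x"

lemma F_iterate_Suc: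
  "(F a b ^^ Suc k) x = 2 * (F a b ^^ k) x + a + b / 2 * S ((F a b ^^ k) x)"
  using F_def[of a b "(F a b ^^ k) x"] by simp

lemma f_to_circle: "f (to_circle a) b (to_circle x) = to_circle (F a b x)"
  by (simp add: f.abs_eq F_def)

lemma f_iterate_to_circle:
  "(f (to_circle a) b ^^ k) (to_circle x) = to_circle ((F a b ^^ k) x)"
  by (induction k) (simp_all add: f_to_circle)

text \<open>
  Up to an affine change, \<open>S\<close> is the distance to the nearest integer; this makes it convex between
  consecutive half-integers, and concave between consecutive integers.
\<close>

lemma S_convex_form:
  assumes "\<bar>x - of_int j\<bar> \<le> 1/2" shows "S x = 4 * \<bar>x - of_int j\<bar> - 1"
proof -
  have S: "S x = S (x - of_int j)" by (rule S_cong) simp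
  show ?thesis
  proof (cases "x \<ge> of_int j")
    case True
    then have "frac (x - of_int j) = x - of_int j" using assms by (subst frac_eq) auto
    with S True assms show ?thesis by (simp add: S_def)
  next
    case False
    then have "\<lfloor>x - of_int j\<rfloor> = -1" using assms by (intro floor_unique) auto
    then have "frac (x - of_int j) = x - of_int j + 1" by (simp add: frac_def)
    with S False assms show ?thesis by (auto simp: S_def abs_if)
  qed
qed

lemma S_eq_dist_Ints: "S x = 4 * dist_Ints x - 1"
  unfolding dist_Ints_def
  by (rule S_convex_form) (use of_int_round_abs_le[of x] in \<open>simp add: abs_minus_commute\<close>)

lemma S_concave_form:
  assumes "of_int j \<le> x" "x \<le> of_int j + 1" shows "S x = 1 - 4 * \<bar>x - (of_int j + 1/2)\<bar>"
proof (cases "x \<le> of_int j + 1/2")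
  case True
  then show ?thesis using assms S_convex_form[of x j] by (auto simp: abs_if)
next
  case False
  then show ?thesis using assms S_convex_form[of x "j+1"] by (auto simp: abs_if)
qed

lemma S_Lipschitz: "\<bar>S x - S y\<bar> \<le> 4 * \<bar>x - y\<bar>"
proof -
  have le: "dist_Ints u \<le> dist_Ints v + \<bar>u - v\<bar>" for u v
  proof -
    obtain m where "m \<in> \<int>" "dist_Ints v = \<bar>v - m\<bar>" using dist_Ints_attained by blast
    then show ?thesis using dist_Ints_le[of m u] by linarith
  qed
  show ?thesis using le[of x y] le[of y x] unfolding S_eq_dist_Ints by (simp add: abs_minus_commute abs_le_iff)
qed

lemma S_bounds: "\<bar>S x\<bar> \<le> 1"
proof -
  have "0 \<le> dist_Ints x" "dist_Ints x \<le> 1/2"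
    using of_int_round_abs_le[of x] by (auto simp: dist_Ints_def abs_minus_commute)
  then show ?thesis by (simp add: S_eq_dist_Ints abs_le_iff)
qed

lemma continuous_S: "continuous_on A S"
proof -
  have "4-lipschitz_on UNIV S" using S_Lipschitz by (auto simp: lipschitz_on_def dist_real_def)
  then show ?thesis
    using lipschitz_on_continuous_on continuous_on_subset by blast
qed

text \<open>
  The Lipschitz constant 4 of \<open>S\<close> bounds the slope of \<open>F\<close> below by \<open>2 - 2b\<close>.
\<close>

lemma F_strict_mono:
  assumes "0 \<le> b" "b < 1" shows "strict_mono (F a b)"
proof (rule strict_monoI)
  fix x y :: real assume "x < y"
  have "b / 2 * \<bar>S y - S x\<bar> \<le> b / 2 * (4 * \<bar>y - x\<bar>)"
    using assms S_Lipschitz by (intro mult_left_mono) auto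
  also have "\<dots> = 2 * b * (y - x)" using \<open>x < y\<close> by simp
  also have "\<dots> < 2 * 1 * (y - x)" using assms \<open>x < y\<close> by (intro mult_strict_right_mono) auto
  finally have "b / 2 * \<bar>S y - S x\<bar> < 2 * (y - x)" by simp
  moreover have "- (b / 2 * \<bar>S y - S x\<bar>) \<le> b / 2 * (S y - S x)"
    using assms mult_left_mono[of "-\<bar>S y - S x\<bar>" "S y - S x" "b/2"] by (simp add: abs_if)
  ultimately show "F a b x < F a b y" by (simp add: F_def right_diff_distrib)
qed

lemma F_iterate_strict_mono:
  assumes "0 \<le> b" "b < 1" shows "strict_mono (F a b ^^ k)"
  by (induction k) (use F_strict_mono[OF assms] in \<open>auto simp: strict_mono_def\<close>)

lemma F_iterate_mono:
  assumes "0 \<le> b" "b < 1" shows "mono (F a b ^^ k)"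
  using F_iterate_strict_mono[OF assms] by (rule strict_mono_mono)

text \<open>
  Joint continuity is what lets strict inequalities between iterates persist when both parameters
  move.
\<close>

lemma continuous_F_iterate:
  "continuous_on UNIV (\<lambda>(a, b, x). (F a b ^^ k) x)"
proof (induction k)
  case 0
  show ?case by (simp add: case_prod_beta continuous_intros)
next
  case (Suc k)
  have "continuous_on UNIV (\<lambda>q. S ((F (fst q) (fst (snd q)) ^^ k) (snd (snd q))))"
    using Suc by (intro continuous_on_compose2[OF continuous_S[of UNIV]]) (auto simp: case_prod_beta)
  then show ?case
    using Suc unfolding F_iterate_Suc case_prod_beta by (intro continuous_intros) auto
qed

lemma continuous_F_iterate_point: "continuous_on A (F a b ^^ k)"
proof -
  have "continuous_on A (\<lambda>x. (\<lambda>(a, b, x). (F a b ^^ k) x) (a, b, x))"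
    by (rule continuous_on_compose2[OF continuous_F_iterate]) (auto intro!: continuous_intros)
  then show ?thesis by simp
qed

lemma tendsto_F_iterate_param:
  "((\<lambda>q. (F (fst q) (snd q) ^^ k) x) \<longlongrightarrow> (F a b ^^ k) x) (nhds (a, b))"
proof -
  let ?g = "\<lambda>q. (F (fst q) (snd q) ^^ k) x"
  have "continuous_on UNIV (\<lambda>q. (\<lambda>(a, b, x). (F a b ^^ k) x) (fst q, snd q, x))"
    by (rule continuous_on_compose2[OF continuous_F_iterate]) (auto intro!: continuous_intros)
  then have "isCont ?g (a, b)"
    by (simp add: continuous_on_eq_continuous_at)
  then show ?thesis
    using tendsto_at_iff_tendsto_nhds[of ?g "(a, b)"] by (simp add: isCont_def)
qed

lemma F_iterate_shift: "(F a b ^^ k) (x + of_int j) = (F a b ^^ k) x + 2 ^ k * of_int j"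
proof (induction k)
  case (Suc k)
  have "S ((F a b ^^ k) x + 2 ^ k * of_int j) = S ((F a b ^^ k) x)"
    by (rule S_cong) simp
  with Suc show ?case unfolding F_iterate_Suc by (simp add: algebra_simps)
qed simp

lemma F_iterate_param_shift:
  "(F (a + of_int j) b ^^ k) x = (F a b ^^ k) x + (2 ^ k - 1) * of_int j"
proof (induction k)
  case (Suc k)
  have "S ((F (a + of_int j) b ^^ k) x) = S ((F a b ^^ k) x)"
    unfolding Suc by (rule S_cong) simp
  with Suc show ?case unfolding F_iterate_Suc by (simp add: algebra_simps)
qed simp

lemma F_iterate_param_mono:
  assumes "0 \<le> b" "b < 1" "a \<le> a'" shows "(F a b ^^ k) x \<le> (F a' b ^^ k) x"
proof (induction k)
  case (Suc k)
  have "F a b ((F a b ^^ k) x) \<le> F a b ((F a' b ^^ k) x)"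
    using F_strict_mono[OF assms(1,2)] Suc by (simp add: strict_mono_less_eq)
  also have "\<dots> \<le> F a' b ((F a' b ^^ k) x)" using assms(3) by (simp add: F_def)
  finally show ?case by simp
qed simp

section \<open>The semiconjugacy\<close>

text \<open>
  The monotone semiconjugacy of degree one from \<open>F a b\<close> to \<open>x \<mapsto> 2x\<close>.
\<close>

definition semiconj :: "real \<Rightarrow> real \<Rightarrow> real \<Rightarrow> real"
  where "semiconj a b x = lim (\<lambda>k. (F a b ^^ k) x / 2 ^ k)"

text \<open>
  Since \<open>F x - 2x\<close> is bounded, the consecutive differences of the sequence are dominated by a
  geometric series.
\<close>

lemma semiconj_LIMSEQ: "(\<lambda>k. (F a b ^^ k) x / 2 ^ k) \<longlonglongrightarrow> semiconj a b x"
proof -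
  define u where "u k = (F a b ^^ k) x / 2 ^ k" for k
  have step: "u (Suc k) - u k = (a + b / 2 * S ((F a b ^^ k) x)) * (1/2) ^ Suc k" for k
    by (simp add: u_def F_def field_simps)
  have "summable (\<lambda>k. u (Suc k) - u k)"
  proof (rule summable_comparison_test')
    show "summable (\<lambda>k. (\<bar>a\<bar> + \<bar>b\<bar>) * (1/2) ^ Suc k :: real)"
      by (intro summable_mult summable_Suc_iff[THEN iffD2] summable_geometric) simp
    fix k
    have "\<bar>b / 2 * S ((F a b ^^ k) x)\<bar> \<le> \<bar>b\<bar> * 1"
      unfolding abs_mult using S_bounds by (intro mult_mono) auto
    then have "\<bar>a + b / 2 * S ((F a b ^^ k) x)\<bar> \<le> \<bar>a\<bar> + \<bar>b\<bar>" by linarith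
    then show "norm (u (Suc k) - u k) \<le> (\<bar>a\<bar> + \<bar>b\<bar>) * (1/2) ^ Suc k"
      unfolding step real_norm_def abs_mult by (intro mult_mono) auto
  qed
  then have "convergent (\<lambda>n. (\<Sum>k<n. u (Suc k) - u k) + u 0)"
    by (intro convergent_add convergent_const) (simp add: summable_iff_convergent)
  then have "convergent u" by (simp add: sum_lessThan_telescope)
  then show ?thesis by (simp add: convergent_LIMSEQ_iff semiconj_def u_def[abs_def])
qed

lemma semiconj_F: "semiconj a b (F a b x) = 2 * semiconj a b x"
proof -
  have "(\<lambda>k. 2 * ((F a b ^^ Suc k) x / 2 ^ Suc k)) \<longlonglongrightarrow> 2 * semiconj a b x"
    by (intro tendsto_mult tendsto_const LIMSEQ_Suc semiconj_LIMSEQ)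
  moreover have "2 * ((F a b ^^ Suc k) x / 2 ^ Suc k) = (F a b ^^ k) (F a b x) / 2 ^ k" for k
    by (simp only: funpow_Suc_right o_apply) simp
  ultimately show ?thesis using semiconj_LIMSEQ LIMSEQ_unique by simp blast
qed

lemma semiconj_F_iterate: "semiconj a b ((F a b ^^ k) x) = 2 ^ k * semiconj a b x"
  by (induction k) (simp_all add: semiconj_F)

lemma semiconj_shift: "semiconj a b (x + of_int j) = semiconj a b x + of_int j"
proof -
  have "(\<lambda>k. (F a b ^^ k) x / 2 ^ k + of_int j) \<longlonglongrightarrow> semiconj a b x + of_int j"
    by (intro tendsto_intros semiconj_LIMSEQ)
  moreover have "(F a b ^^ k) x / 2 ^ k + of_int j = (F a b ^^ k) (x + of_int j) / 2 ^ k" for k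
    by (simp add: F_iterate_shift field_simps)
  ultimately show ?thesis using semiconj_LIMSEQ LIMSEQ_unique by simp blast
qed

lemma semiconj_mono: assumes "0 \<le> b" "b < 1" "x \<le> y" shows "semiconj a b x \<le> semiconj a b y"
proof (rule LIMSEQ_le[OF semiconj_LIMSEQ semiconj_LIMSEQ], intro exI allI impI)
  show "(F a b ^^ k) x / 2 ^ k \<le> (F a b ^^ k) y / 2 ^ k" for k
    using monoD[OF F_iterate_mono[OF assms(1,2)] assms(3)] by (simp add: divide_right_mono)
qed

section \<open>Return maps\<close>

text \<open>
  For \<open>\<theta>\<close> of period \<open>n\<close> under doubling modulo 1, this is the lift of the \<open>n\<close>-th iterate of the
  circle map that preserves the fibre of \<open>semiconj\<close> over the real number \<open>\<theta>\<close>. Indexing it by \<open>\<theta>\<close>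
  instead of the integer \<open>(2\<^sup>n - 1) \<theta>\<close> records which fibre is meant.
\<close>

definition ret :: "real \<Rightarrow> real \<Rightarrow> nat \<Rightarrow> real \<Rightarrow> real \<Rightarrow> real"
  where "ret a b n \<theta> x = (F a b ^^ n) x - (2 ^ n - 1) * \<theta>"

text \<open>
  The point \<open>\<theta>\<close> has exact period \<open>n\<close> under doubling modulo 1.
\<close>

definition doubling_period :: "nat \<Rightarrow> real \<Rightarrow> bool"
  where "doubling_period n \<theta> \<longleftrightarrow> n \<ge> 1 \<and> (2 ^ n - 1) * \<theta> \<in> \<int> \<and>
    (\<forall>i. 0 < i \<and> i < n \<longrightarrow> (2 ^ i - 1) * \<theta> \<notin> \<int>)"

text \<open>
  The return map multiplies the deviation of \<open>semiconj x\<close> from \<open>\<theta>\<close> by \<open>2\<^sup>n\<close>. As \<open>semiconj\<close> is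
  monotone, a point that the return map moves to the right must therefore have nonnegative
  deviation, and one moved to the left nonpositive deviation.
\<close>

lemma semiconj_ret:
  assumes "(2 ^ n - 1) * \<theta> \<in> \<int>" shows "semiconj a b (ret a b n \<theta> x) - \<theta> = 2 ^ n * (semiconj a b x - \<theta>)"
proof -
  obtain j where j: "(2 ^ n - 1) * \<theta> = of_int j" using assms by (elim Ints_cases)
  have "semiconj a b (ret a b n \<theta> x) = semiconj a b ((F a b ^^ n) x + of_int (- j))" by (simp add: ret_def j)
  also have "\<dots> = 2 ^ n * semiconj a b x - (2 ^ n - 1) * \<theta>" unfolding semiconj_shift semiconj_F_iterate by (simp add: j)
  finally show ?thesis by (simp add: algebra_simps)
qed

lemma two_power_gt_1: "n \<ge> 1 \<Longrightarrow> (2::real) ^ n > 1"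
  by (metis One_nat_def Suc_le_lessD one_less_numeral_iff one_less_power semiring_norm(76))

lemma le_semiconj_if_le_ret:
  assumes "0 \<le> b" "b < 1" "n \<ge> 1" "(2 ^ n - 1) * \<theta> \<in> \<int>" "x \<le> ret a b n \<theta> x"
  shows "\<theta> \<le> semiconj a b x"
proof -
  have "semiconj a b x - \<theta> \<le> 2 ^ n * (semiconj a b x - \<theta>)"
    using semiconj_mono[OF assms(1,2,5)] semiconj_ret[OF assms(4)] by (metis diff_right_mono)
  then have "0 \<le> (2 ^ n - 1) * (semiconj a b x - \<theta>)" by (simp add: algebra_simps)
  then show ?thesis using two_power_gt_1[OF assms(3)] by (simp add: zero_le_mult_iff)
qed

lemma semiconj_le_if_ret_le:
  assumes "0 \<le> b" "b < 1" "n \<ge> 1" "(2 ^ n - 1) * \<theta> \<in> \<int>" "ret a b n \<theta> x \<le> x"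
  shows "semiconj a b x \<le> \<theta>"
proof -
  have "2 ^ n * (semiconj a b x - \<theta>) \<le> semiconj a b x - \<theta>"
    using semiconj_mono[OF assms(1,2,5)] semiconj_ret[OF assms(4)] by (metis diff_right_mono)
  then have "(2 ^ n - 1) * (semiconj a b x - \<theta>) \<le> 0" by (simp add: algebra_simps)
  then show ?thesis using two_power_gt_1[OF assms(3)] by (simp add: mult_le_0_iff)
qed

text \<open>
  In particular an interval that the return map sends into itself is contained in one fibre.
\<close>

lemma semiconj_eq_on_trapped:
  assumes "0 \<le> b" "b < 1" "n \<ge> 1" "(2 ^ n - 1) * \<theta> \<in> \<int>"
    and "u \<le> ret a b n \<theta> u" "ret a b n \<theta> v \<le> v" "u \<le> x" "x \<le> v"
  shows "semiconj a b x = \<theta>"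
  using le_semiconj_if_le_ret[OF assms(1-5)] semiconj_le_if_ret_le[OF assms(1-4,6)]
    semiconj_mono[OF assms(1,2,7)] semiconj_mono[OF assms(1,2,8)]
  by (metis order_antisym order_trans)

text \<open>
  The fibres over the \<open>n\<close> points of the doubling orbit of \<open>\<theta>\<close> are disjoint modulo 1, so points of
  the fibre over \<open>\<theta>\<close> that land on the same point of the circle within \<open>n\<close> steps need the same
  number of steps; injectivity of the iterates then identifies them.
\<close>

lemma fiber_hits_once:
  assumes b: "0 \<le> b" "b < 1" and per: "doubling_period n \<theta>"
    and hx: "semiconj a b x = \<theta>" and hy: "semiconj a b y = \<theta>"
    and lt: "i < n" "k < n" and int: "(F a b ^^ i) x - (F a b ^^ k) y \<in> \<int>"
  shows "x = y"
proof -
  obtain j where j: "(F a b ^^ i) x - (F a b ^^ k) y = of_int j" using int by (elim Ints_cases)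
  then have "(F a b ^^ i) x = (F a b ^^ k) y + of_int j" by simp
  then have eq: "2 ^ i * \<theta> = 2 ^ k * \<theta> + of_int j" using semiconj_shift semiconj_F_iterate hx hy by metis
  have le: "i = k" if "i \<le> k" "k < n" "(2 ^ k - 2 ^ i) * \<theta> \<in> \<int>" for i k
  proof (rule ccontr)
    assume "i \<noteq> k"
    then have lt: "0 < k - i" "k - i < n" using that by auto
    (* Moving on by n - i steps turns the coincidence of the i-th and k-th image of \<theta> into a return
       of \<theta> to itself after k - i steps. *)
    have "2 ^ (n - i) * ((2 ^ k - 2 ^ i) * \<theta>) \<in> \<int>"
      using that(3) by (rule Ints_mult[rotated]) simp
    also have "2 ^ (n - i) * ((2 ^ k - 2 ^ i) * \<theta>) = (2 ^ (k - i) - 1) * 2 ^ n * \<theta>"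
    proof -
      have "(2::real) ^ k = 2 ^ (k - i) * 2 ^ i" "(2::real) ^ n = 2 ^ (n - i) * 2 ^ i"
        using that by (simp_all flip: power_add)
      then show ?thesis by (simp add: algebra_simps)
    qed
    finally have "(2 ^ (k - i) - 1) * 2 ^ n * \<theta> \<in> \<int>" .
    moreover have "(2 ^ (k - i) - 1) * ((2 ^ n - 1) * \<theta>) \<in> \<int>"
      using per by (intro Ints_mult[of "2 ^ (k - i) - 1"]) (simp_all add: doubling_period_def)
    ultimately have "(2 ^ (k - i) - 1) * 2 ^ n * \<theta> - (2 ^ (k - i) - 1) * ((2 ^ n - 1) * \<theta>) \<in> \<int>"
      by (rule Ints_diff)
    also have "(2 ^ (k - i) - 1) * 2 ^ n * \<theta> - (2 ^ (k - i) - 1) * ((2 ^ n - 1) * \<theta>)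
      = (2 ^ (k - i) - 1) * \<theta>" by (simp add: algebra_simps)
    finally show False using per lt by (auto simp: doubling_period_def)
  qed
  have "(2 ^ i - 2 ^ k) * \<theta> = of_int j" "(2 ^ k - 2 ^ i) * \<theta> = of_int (- j)"
    using eq by (simp_all add: algebra_simps)
  then have "i = k" using le[of i k] le[of k i] lt by (metis Ints_of_int nat_le_linear)
  then have "(F a b ^^ i) x = (F a b ^^ i) y" using eq j by simp
  then show ?thesis using F_iterate_strict_mono[OF b] by (simp add: strict_mono_eq)
qed

section \<open>Convexity\<close>

lemma between_consecutive:
  assumes b: "0 \<le> b" "b < 1" and "x < y"
    and avoid: "\<And>z. x < z \<Longrightarrow> z < y \<Longrightarrow> (F a b ^^ i) z - s \<notin> \<int>"
  obtains j :: int where "of_int j + s \<le> (F a b ^^ i) x" "(F a b ^^ i) y \<le> of_int j + 1 + s"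
proof
  let ?g = "F a b ^^ i"
  let ?j = "\<lfloor>?g x - s\<rfloor>"
  show "of_int ?j + s \<le> ?g x" by linarith
  have lt: "?g x < of_int ?j + 1 + s" by linarith
  show "?g y \<le> of_int ?j + 1 + s"
  proof (rule ccontr)
    assume "\<not> ?g y \<le> of_int ?j + 1 + s"
    with lt \<open>x < y\<close> obtain z where z: "x \<le> z" "z \<le> y" "?g z = of_int ?j + 1 + s"
      using IVT'[of ?g x "of_int ?j + 1 + s" y] continuous_F_iterate_point by force
    with lt \<open>\<not> _\<close> have "x < z" "z < y" by (auto simp: order_less_le)
    moreover have "?g z - s = of_int (?j + 1)" using z by simp
    ultimately show False using avoid by (metis Ints_of_int)
  qed
qed

text \<open>
  On a unit interval centred at an integer the only kink of \<open>F\<close> is the integer, where the slope rises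
  from \<open>2 - 2b\<close> to \<open>2 + 2b\<close>.
\<close>

lemma F_convex_on: assumes "0 \<le> b" shows "convex_on {of_int j + 1/2..of_int j + 1 + 1/2} (F a b)"
proof (rule convex_onI)
  fix t x y :: real
  assume t: "0 < t" "t < 1" and x: "x \<in> {of_int j + 1/2..of_int j + 1 + 1/2}"
    and y: "y \<in> {of_int j + 1/2..of_int j + 1 + 1/2}"
  define z where "z = (1 - t) *\<^sub>R x + t *\<^sub>R y"
  define c where "c = (of_int j + 1 :: real)"
  have "z \<in> {of_int j + 1/2..of_int j + 1 + 1/2}"
    unfolding z_def by (rule convexD[OF convex_real_interval(5) x y]) (use t in auto)
  with x y have S: "S w = 4 * \<bar>w - c\<bar> - 1" if "w \<in> {x, y, z}" for w
    using that S_convex_form[of w "j + 1"] by (auto simp: abs_if c_def)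
  have "z - c = (1 - t) * (x - c) + t * (y - c)" by (simp add: z_def algebra_simps)
  then have "\<bar>z - c\<bar> \<le> \<bar>(1 - t) * (x - c)\<bar> + \<bar>t * (y - c)\<bar>" by linarith
  also have "\<dots> = (1 - t) * \<bar>x - c\<bar> + t * \<bar>y - c\<bar>" using t by (simp add: abs_mult)
  finally have "S z \<le> (1 - t) * S x + t * S y" by (simp add: S algebra_simps)
  moreover define e where "e = b / 2"
  ultimately have "e * S z \<le> e * ((1 - t) * S x + t * S y)"
    using assms by (intro mult_left_mono) auto
  moreover have F_expand: "F a b w = 2 * w + a + e * S w" for w by (simp add: F_def e_def)
  ultimately show "F a b ((1 - t) *\<^sub>R x + t *\<^sub>R y) \<le> (1 - t) * F a b x + t * F a b y"
    unfolding z_def[symmetric] F_expand by (simp add: z_def algebra_simps)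
qed (rule convex_real_interval)

text \<open>
  On a unit interval centred at a half-integer the slope drops from \<open>2 + 2b\<close> to \<open>2 - 2b\<close>.
\<close>

lemma F_concave_on: assumes "0 \<le> b" shows "concave_on {of_int j..of_int j + 1} (F a b)"
  unfolding concave_on_def
proof (rule convex_onI)
  fix t x y :: real
  assume t: "0 < t" "t < 1" and x: "x \<in> {of_int j..of_int j + 1}"
    and y: "y \<in> {of_int j..of_int j + 1}"
  define z where "z = (1 - t) *\<^sub>R x + t *\<^sub>R y"
  define c where "c = (of_int j + 1/2 :: real)"
  have "z \<in> {of_int j..of_int j + 1}"
    unfolding z_def by (rule convexD[OF convex_real_interval(5) x y]) (use t in auto)
  with x y have S: "S w = 1 - 4 * \<bar>w - c\<bar>" if "w \<in> {x, y, z}" for w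
    using that S_concave_form[of j w] by (auto simp: c_def)
  have "z - c = (1 - t) * (x - c) + t * (y - c)" by (simp add: z_def algebra_simps)
  then have "\<bar>z - c\<bar> \<le> \<bar>(1 - t) * (x - c)\<bar> + \<bar>t * (y - c)\<bar>" by linarith
  also have "\<dots> = (1 - t) * \<bar>x - c\<bar> + t * \<bar>y - c\<bar>" using t by (simp add: abs_mult)
  finally have "(1 - t) * S x + t * S y \<le> S z" by (simp add: S algebra_simps)
  moreover define e where "e = b / 2"
  ultimately have "e * ((1 - t) * S x + t * S y) \<le> e * S z"
    using assms by (intro mult_left_mono) auto
  moreover have F_expand: "F a b w = 2 * w + a + e * S w" for w by (simp add: F_def e_def)
  ultimately show "- F a b ((1 - t) *\<^sub>R x + t *\<^sub>R y) \<le> (1 - t) * - F a b x + t * - F a b y"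
    unfolding z_def[symmetric] F_expand by (simp add: z_def algebra_simps)
qed (rule convex_real_interval)

text \<open>
  As long as an interval avoids the half-integers, each further application of \<open>F\<close> composes an
  increasing convex function with a convex one.
\<close>

lemma F_iterate_convex_on:
  assumes b: "0 \<le> b" "b < 1" and "x < y"
    and avoid: "\<And>i z. i < n \<Longrightarrow> x < z \<Longrightarrow> z < y \<Longrightarrow> (F a b ^^ i) z - 1/2 \<notin> \<int>"
  shows "convex_on {x..y} (F a b ^^ n)"
  using avoid
proof (induction n)
  case 0
  show ?case by (simp add: convex_on_def algebra_simps)
next
  case (Suc n)
  let ?g = "F a b ^^ n"
  obtain j where j: "of_int j + 1/2 \<le> ?g x" "?g y \<le> of_int j + 1 + 1/2"
    using between_consecutive[OF b \<open>x < y\<close>, where s = "1/2" and i = n and a = a] Suc.prems by blast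
  have in_range: "?g z \<in> {of_int j + 1/2..of_int j + 1 + 1/2}" if "z \<in> {x..y}" for z
    using that j monoD[OF F_iterate_mono[OF b], of x z n a] monoD[OF F_iterate_mono[OF b], of z y n a]
    by auto
  have conv: "convex_on {x..y} ?g" using Suc by simp
  show ?case
  proof (rule convex_onI)
    fix t u v :: real
    assume t: "0 < t" "t < 1" and u: "u \<in> {x..y}" and v: "v \<in> {x..y}"
    have "F a b (?g ((1 - t) *\<^sub>R u + t *\<^sub>R v)) \<le> F a b ((1 - t) * ?g u + t * ?g v)"
      using convex_onD[OF conv, of t u v] t u v F_strict_mono[OF b]
      by (simp add: strict_mono_less_eq)
    also have "\<dots> \<le> (1 - t) * F a b (?g u) + t * F a b (?g v)"
      using convex_onD[OF F_convex_on[OF b(1)], of t "?g u" j "?g v"] t in_range[OF u] in_range[OF v]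
      by simp
    finally show "(F a b ^^ Suc n) ((1 - t) *\<^sub>R u + t *\<^sub>R v)
      \<le> (1 - t) * (F a b ^^ Suc n) u + t * (F a b ^^ Suc n) v" by simp
  qed (rule convex_real_interval)
qed

lemma F_iterate_concave_on:
  assumes b: "0 \<le> b" "b < 1" and "x < y"
    and avoid: "\<And>i z. i < n \<Longrightarrow> x < z \<Longrightarrow> z < y \<Longrightarrow> (F a b ^^ i) z \<notin> \<int>"
  shows "concave_on {x..y} (F a b ^^ n)"
  using avoid
proof (induction n)
  case 0
  show ?case by (simp add: concave_on_def convex_on_def algebra_simps)
next
  case (Suc n)
  let ?g = "F a b ^^ n"
  obtain j where j: "of_int j + 0 \<le> ?g x" "?g y \<le> of_int j + 1 + 0"
    using between_consecutive[OF b \<open>x < y\<close>, where s = 0 and i = n and a = a] Suc.prems by auto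
  have in_range: "?g z \<in> {of_int j..of_int j + 1}" if "z \<in> {x..y}" for z
    using that j monoD[OF F_iterate_mono[OF b], of x z n a] monoD[OF F_iterate_mono[OF b], of z y n a]
    by auto
  have conc: "concave_on {x..y} ?g" using Suc by simp
  show ?case
    unfolding concave_on_def
  proof (rule convex_onI)
    fix t u v :: real
    assume t: "0 < t" "t < 1" and u: "u \<in> {x..y}" and v: "v \<in> {x..y}"
    have "(1 - t) * F a b (?g u) + t * F a b (?g v) \<le> F a b ((1 - t) * ?g u + t * ?g v)"
      using concave_onD[OF F_concave_on[OF b(1), of j a], of t "?g u" "?g v"]
        t in_range[OF u] in_range[OF v]
      by simp
    also have "\<dots> \<le> F a b (?g ((1 - t) *\<^sub>R u + t *\<^sub>R v))"
      using concave_onD[OF conc, of t u v] t u v F_strict_mono[OF b]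
      by (simp add: strict_mono_less_eq)
    finally show "- (F a b ^^ Suc n) ((1 - t) *\<^sub>R u + t *\<^sub>R v)
      \<le> (1 - t) * - (F a b ^^ Suc n) u + t * - (F a b ^^ Suc n) v" by simp
  qed (rule convex_real_interval)
qed

lemma convex_on_less_diagonal:
  fixes g :: "real \<Rightarrow> real"
  assumes conv: "convex_on {u..w} g" and z: "u < z" "z < w" and le: "g u \<le> u" "g w < w"
  shows "g z < z"
proof -
  define t where "t = (z - u) / (w - u)"
  have t: "0 < t" "t < 1" using z by (auto simp: t_def)
  have "t * (w - u) = z - u" using z by (simp add: t_def)
  then have z_eq: "z = (1 - t) * u + t * w" by (simp add: algebra_simps)
  then have "g z \<le> (1 - t) * g u + t * g w"
    using convex_onD[OF conv, of t u w] t z by simp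
  also have "\<dots> < (1 - t) * u + t * w"
    using t le by (intro add_le_less_mono mult_left_mono mult_strict_left_mono) auto
  finally show ?thesis using z_eq by simp
qed

lemma convex_on_le_diagonal:
  fixes g :: "real \<Rightarrow> real"
  assumes conv: "convex_on {u..w} g" and z: "u \<le> z" "z \<le> w" and le: "g u \<le> u" "g w \<le> w"
  shows "g z \<le> z"
proof -
  have "convex_on {u..w} (\<lambda>x. g x - x)"
    using conv by (intro convex_on_diff) (simp_all add: concave_on_ident)
  then have "g z - z \<le> max (g u - u) (g w - w)"
    by (rule convex_on_le_max) (use z in auto)
  then show ?thesis using le by auto
qed

lemma concave_on_ge_diagonal:
  fixes g :: "real \<Rightarrow> real"
  assumes conc: "concave_on {u..w} g" and z: "u \<le> z" "z \<le> w" and ge: "u \<le> g u" "w \<le> g w"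
  shows "z \<le> g z"
proof -
  have "convex_on {u..w} (\<lambda>x. x - g x)"
    using conc by (intro convex_on_diff) (simp_all add: convex_on_ident)
  then have "z - g z \<le> max (u - g u) (w - g w)"
    by (rule convex_on_le_max) (use z in auto)
  then show ?thesis using ge by auto
qed

lemma ret_convex_on:
  assumes "0 \<le> b" "b < 1" "x < y"
    and "\<And>i z. i < n \<Longrightarrow> x < z \<Longrightarrow> z < y \<Longrightarrow> (F a b ^^ i) z - 1/2 \<notin> \<int>"
  shows "convex_on {x..y} (ret a b n \<theta>)"
proof -
  have "convex_on {x..y} (\<lambda>z. (F a b ^^ n) z - (2 ^ n - 1) * \<theta>)"
    using F_iterate_convex_on[OF assms] by (intro convex_on_diff) (auto simp: concave_on_const)
  then show ?thesis by (simp add: ret_def[abs_def])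
qed

lemma ret_concave_on:
  assumes "0 \<le> b" "b < 1" "x < y"
    and "\<And>i z. i < n \<Longrightarrow> x < z \<Longrightarrow> z < y \<Longrightarrow> (F a b ^^ i) z \<notin> \<int>"
  shows "concave_on {x..y} (ret a b n \<theta>)"
proof -
  have "concave_on {x..y} (\<lambda>z. (F a b ^^ n) z - (2 ^ n - 1) * \<theta>)"
    using F_iterate_concave_on[OF assms] by (intro concave_on_diff) (auto simp: convex_on_const)
  then show ?thesis by (simp add: ret_def[abs_def])
qed

lemma ret_strict_mono:
  assumes "0 \<le> b" "b < 1" shows "strict_mono (ret a b n \<theta>)"
  using F_iterate_strict_mono[OF assms] by (simp add: ret_def strict_mono_def)

lemma continuous_ret: "continuous_on A (ret a b n \<theta>)"
  unfolding ret_def[abs_def] by (intro continuous_intros continuous_F_iterate_point)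

lemma to_circle_ret:
  assumes "(2 ^ n - 1) * \<theta> \<in> \<int>"
  shows "to_circle (ret a b n \<theta> x) = (f (to_circle a) b ^^ n) (to_circle x)"
  using Ints_minus[OF assms] by (simp add: f_iterate_to_circle ret_def to_circle_eq_iff)

section \<open>Attracting fixed points of circle maps with a lift\<close>

lemma iterate_to_circle:
  assumes "\<And>x. to_circle (G x) = g (to_circle x)"
  shows "(g ^^ k) (to_circle x) = to_circle ((G ^^ k) x)"
  by (induction k) (simp_all add: assms)

lemma continuous_iterate:
  fixes G :: "real \<Rightarrow> real"
  assumes "continuous_on UNIV G" shows "continuous_on A (G ^^ k)"
proof -
  have "continuous_on UNIV (G ^^ k)"
  proof (induction k)
    case (Suc k)
    then show ?case using continuous_on_compose2[OF assms Suc] by (simp add: o_def)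
  qed (simp add: id_def)
  then show ?thesis using continuous_on_subset by blast
qed

lemma iterates_increase_to:
  fixes G :: "real \<Rightarrow> real"
  assumes mono: "mono G" and cont: "continuous_on UNIV G" and fp: "G x = x" and "u \<le> x"
    and above: "\<And>z. u \<le> z \<Longrightarrow> z < x \<Longrightarrow> z < G z"
  shows "(\<lambda>k. (G ^^ k) u) \<longlonglongrightarrow> x"
proof -
  have bounds: "u \<le> (G ^^ k) u \<and> (G ^^ k) u \<le> x \<and> (G ^^ k) u \<le> (G ^^ Suc k) u" for k
  proof (induction k)
    case 0
    show ?case using above[of u] fp \<open>u \<le> x\<close> by (cases "u = x") auto
  next
    case (Suc k)
    then have "G ((G ^^ k) u) \<le> G x" "G ((G ^^ k) u) \<le> G ((G ^^ Suc k) u)"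
      using mono by (auto simp: mono_def)
    with Suc fp show ?case by auto
  qed
  then have "incseq (\<lambda>k. (G ^^ k) u)" by (intro incseq_SucI) blast
  then obtain L where L: "(\<lambda>k. (G ^^ k) u) \<longlonglongrightarrow> L" using bounds incseq_convergent by meson
  have "u \<le> L" "L \<le> x" using bounds L by (meson LIMSEQ_le_const LIMSEQ_le_const2)+
  have "(\<lambda>k. G ((G ^^ k) u)) \<longlonglongrightarrow> G L"
    using cont L by (intro isCont_tendsto_compose[of L G]) (auto simp: continuous_on_eq_continuous_at)
  then have "(\<lambda>k. (G ^^ Suc k) u) \<longlonglongrightarrow> G L" by simp
  then have "G L = L" using LIMSEQ_Suc[OF L] LIMSEQ_unique by blast
  with above[of L] \<open>u \<le> L\<close> \<open>L \<le> x\<close> have "L = x" by force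
  with L show ?thesis by simp
qed

lemma iterates_decrease_to:
  fixes G :: "real \<Rightarrow> real"
  assumes mono: "mono G" and cont: "continuous_on UNIV G" and fp: "G x = x" and "x \<le> v"
    and below: "\<And>z. x < z \<Longrightarrow> z \<le> v \<Longrightarrow> G z < z"
  shows "(\<lambda>k. (G ^^ k) v) \<longlonglongrightarrow> x"
proof -
  let ?H = "\<lambda>z. - G (- z)"
  have iter: "(?H ^^ k) (- v) = - (G ^^ k) v" for k by (induction k) simp_all
  have "(\<lambda>k. (?H ^^ k) (- v)) \<longlonglongrightarrow> - x"
  proof (rule iterates_increase_to)
    show "mono ?H" using mono by (simp add: mono_def)
    show "continuous_on UNIV ?H"
      by (intro continuous_intros continuous_on_compose2[OF cont]) auto
    show "z < ?H z" if "- v \<le> z" "z < - x" for z using below[of "- z"] that by linarith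
  qed (use fp \<open>x \<le> v\<close> in simp_all)
  then show ?thesis unfolding iter by (rule tendsto_minus_cancel)
qed

text \<open>
  By monotonicity the iterates of all points between \<open>u\<close> and \<open>v\<close> are squeezed between the iterates
  of \<open>u\<close> and of \<open>v\<close>, which makes the convergence uniform.
\<close>

lemma attracting_fixed_point_if_crossing:
  assumes lift: "\<And>x. to_circle (G x) = g (to_circle x)"
    and mono: "mono G" and cont: "continuous_on UNIV G" and fp: "G x = x" and "u < x" "x < v"
    and above: "\<And>z. u \<le> z \<Longrightarrow> z < x \<Longrightarrow> z < G z"
    and below: "\<And>z. x < z \<Longrightarrow> z \<le> v \<Longrightarrow> G z < z"
  shows "attracting_fixed_point g (to_circle x)"
  unfolding attracting_fixed_point_def
proof (intro conjI exI)
  show "g (to_circle x) = to_circle x" using lift[of x] fp by simp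
  show "open (to_circle ` {u<..<v})" by (rule open_to_circle_image) simp
  show "to_circle x \<in> to_circle ` {u<..<v}" using \<open>u < x\<close> \<open>x < v\<close> by simp
  have lim: "(\<lambda>k. (G ^^ k) u) \<longlonglongrightarrow> x" "(\<lambda>k. (G ^^ k) v) \<longlonglongrightarrow> x"
    by (rule iterates_increase_to[OF mono cont fp less_imp_le[OF \<open>u < x\<close>] above]
        iterates_decrease_to[OF mono cont fp less_imp_le[OF \<open>x < v\<close>] below]; assumption)+
  show "uniform_limit (to_circle ` {u<..<v}) (\<lambda>k. g ^^ k) (\<lambda>_. to_circle x) sequentially"
    unfolding uniform_limit_iff
  proof (intro allI impI)
    fix e :: real assume "e > 0"
    with lim have "\<forall>\<^sub>F k in sequentially. dist ((G ^^ k) u) x < e \<and> dist ((G ^^ k) v) x < e"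
      by (intro eventually_conj) (auto simp: tendsto_iff)
    then show "\<forall>\<^sub>F k in sequentially. \<forall>c\<in>to_circle ` {u<..<v}. dist ((g ^^ k) c) (to_circle x) < e"
    proof eventually_elim
      case (elim k)
      have "mono (G ^^ k)" using mono by (rule mono_pow)
      then have "dist ((G ^^ k) z) x < e" if "u < z" "z < v" for z
        using that elim monoD[of "G ^^ k" u z] monoD[of "G ^^ k" z v] by (auto simp: dist_real_def)
      moreover have "(g ^^ k) (to_circle z) = to_circle ((G ^^ k) z)" for z
        using lift by (rule iterate_to_circle)
      ultimately show ?case
        using order_le_less_trans[OF dist_to_circle_le] by (simp add: dist_real_def)
    qed
  qed
qed

text \<open>
  Uniform convergence on the circle only controls the lifted iterates modulo 1; by connectedness they
  cannot have travelled once around the circle, so eventually they converge on the line as well. If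
  \<open>G\<close> moved a nearby point away from \<open>p\<close>, monotonicity would keep all its iterates away from \<open>p\<close>.
\<close>

lemma crossing_if_attracting_fixed_point:
  assumes lift: "\<And>x. to_circle (G x) = g (to_circle x)"
    and mono: "mono G" and cont: "continuous_on UNIV G" and fp: "G p = p"
    and attr: "attracting_fixed_point g (to_circle p)"
  obtains e where "e > 0" "\<And>z. p - e < z \<Longrightarrow> z < p \<Longrightarrow> z < G z"
    "\<And>z. p < z \<Longrightarrow> z < p + e \<Longrightarrow> G z < z"
proof -
  obtain V where V: "open V" "to_circle p \<in> V"
    and unif: "uniform_limit V (\<lambda>k. g ^^ k) (\<lambda>_. to_circle p) sequentially"
    using attr unfolding attracting_fixed_point_def by blast
  have "open (to_circle -` V)" "p \<in> to_circle -` V" 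
    using V open_circle_iff[of V] by simp_all
  then obtain e where e_pos: "e > 0" and e: "ball p e \<subseteq> to_circle -` V"
    by (rule openE)
  have e: "to_circle z \<in> V" if "\<bar>z - p\<bar> < e" for z
    using subsetD[OF e, of z] that by (simp_all add: dist_real_def abs_minus_commute)
  have unif: "\<exists>K. \<forall>k\<ge>K. \<forall>z. \<bar>z - p\<bar> < e \<longrightarrow> dist_Ints ((G ^^ k) z - p) < d" if "d > 0" for d
  proof -
    obtain K where K: "\<forall>k\<ge>K. \<forall>c\<in>V. dist ((g ^^ k) c) (to_circle p) < d"
      using unif \<open>d > 0\<close> unfolding uniform_limit_iff eventually_sequentially by blast
    have "dist_Ints ((G ^^ k) z - p) < d" if "k \<ge> K" "\<bar>z - p\<bar> < e" for k z
    proof -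
      have "dist ((g ^^ k) (to_circle z)) (to_circle p) < d" using K e that by blast
      then show ?thesis unfolding iterate_to_circle[of G g, OF lift] dist_to_circle .
    qed
    then show ?thesis by blast
  qed
  obtain K where K: "\<And>k z. k \<ge> K \<Longrightarrow> \<bar>z - p\<bar> < e \<Longrightarrow> dist_Ints ((G ^^ k) z - p) < 1/2"
    using unif[OF half_gt_zero[OF zero_less_one]] by blast
  have fix_iter: "(G ^^ k) p = p" for k by (induction k) (simp_all add: fp)
  have small: "\<bar>(G ^^ k) z - p\<bar> < 1/2" if "k \<ge> K" "\<bar>z - p\<bar> < e" for k z
  proof (rule ccontr)
    assume *: "\<not> \<bar>(G ^^ k) z - p\<bar> < 1/2"
    (* At distance exactly 1/2 from p on the line the distance on the circle is also 1/2, which the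
       choice of K excludes. *)
    have "\<exists>y\<in>closed_segment p z. \<bar>(G ^^ k) y - p\<bar> = 1/2"
    proof -
      let ?A = "(\<lambda>y. \<bar>(G ^^ k) y - p\<bar>) ` closed_segment p z"
      have "connected ?A"
        by (intro connected_continuous_image continuous_intros continuous_iterate cont) auto
      moreover have "\<bar>(G ^^ k) p - p\<bar> \<in> ?A" "\<bar>(G ^^ k) z - p\<bar> \<in> ?A"
        by (intro imageI ends_in_segment)+
      then have "0 \<in> ?A" "\<bar>(G ^^ k) z - p\<bar> \<in> ?A" unfolding fix_iter by simp_all
      moreover have "1/2 \<le> \<bar>(G ^^ k) z - p\<bar>" using * by simp
      ultimately have "1/2 \<in> ?A"
        by (elim connectedD_interval[of ?A 0 "\<bar>(G ^^ k) z - p\<bar>" "1/2"]) simp_all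
      then obtain y where "y \<in> closed_segment p z" "1/2 = \<bar>(G ^^ k) y - p\<bar>" by (rule imageE)
      then show ?thesis by (intro bexI[of _ y]) simp_all
    qed
    then obtain y where y: "y \<in> closed_segment p z" "\<bar>(G ^^ k) y - p\<bar> = 1/2" by blast
    then have "\<bar>y - p\<bar> < e" using that(2) by (auto simp: closed_segment_eq_real_ivl split: if_splits)
    with K[OF that(1)] dist_Ints_half[OF y(2)] show False by force
  qed
  have close: "\<exists>k. \<bar>(G ^^ k) z - p\<bar> < d" if d: "d > 0" and z: "\<bar>z - p\<bar> < e" for d z
  proof -
    obtain L where "\<And>k. k \<ge> L \<Longrightarrow> dist_Ints ((G ^^ k) z - p) < d" using unif[OF d] z by blast
    then have "dist_Ints ((G ^^ max K L) z - p) < d" using max.cobounded2 .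
    then have "\<bar>(G ^^ max K L) z - p\<bar> < d"
      using dist_Ints_small[OF small[OF max.cobounded1 z]] by simp
    then show ?thesis ..
  qed
  show ?thesis
  proof (rule that[OF e_pos])
    fix z assume z: "p - e < z" "z < p"
    show "z < G z"
    proof (rule ccontr)
      assume "\<not> z < G z"
      have le: "(G ^^ k) z \<le> z" for k
      proof (induction k)
        case (Suc k)
        then have "G ((G ^^ k) z) \<le> G z" using mono by (auto simp: mono_def)
        with \<open>\<not> z < G z\<close> show ?case by simp
      qed simp
      have "\<exists>k. \<bar>(G ^^ k) z - p\<bar> < p - z" using z by (intro close) auto
      then obtain k where "\<bar>(G ^^ k) z - p\<bar> < p - z" ..
      with le[of k] show False by linarith
    qed
  next
    fix z assume z: "p < z" "z < p + e"
    show "G z < z"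
    proof (rule ccontr)
      assume "\<not> G z < z"
      have le: "z \<le> (G ^^ k) z" for k
      proof (induction k)
        case (Suc k)
        then have "G z \<le> G ((G ^^ k) z)" using mono by (auto simp: mono_def)
        with \<open>\<not> G z < z\<close> show ?case by simp
      qed simp
      have "\<exists>k. \<bar>(G ^^ k) z - p\<bar> < z - p" using z by (intro close) auto
      then obtain k where "\<bar>(G ^^ k) z - p\<bar> < z - p" ..
      with le[of k] show False by linarith
    qed
  qed
qed

section \<open>Periodic points and attracting cycles\<close>

lemma funpow_fixed: "(g ^^ n) x = x \<Longrightarrow> (g ^^ (n * k)) x = x"
  by (induction k) (simp_all add: funpow_add)

lemma has_period_step: assumes "has_period g n x" shows "has_period g n (g x)"
proof -
  have n: "n \<ge> 1" and x: "(g ^^ n) x = x"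
    and least: "\<And>m. 1 \<le> m \<Longrightarrow> m < n \<Longrightarrow> (g ^^ m) x \<noteq> x"
    using assms by (auto simp: has_period_def)
  have comm: "(g ^^ m) (g y) = g ((g ^^ m) y)" for m y by (simp add: funpow_swap1)
  have closes: "(g ^^ (n - 1)) (g y) = (g ^^ n) y" for y
    using n by (cases n) (simp_all add: funpow_swap1)
  have "(g ^^ m) (g x) \<noteq> g x" if "1 \<le> m" "m < n" for m
  proof
    assume "(g ^^ m) (g x) = g x"
    then have "(g ^^ n) ((g ^^ m) x) = (g ^^ n) x" using closes comm by metis
    moreover have "(g ^^ n) ((g ^^ m) x) = (g ^^ m) ((g ^^ n) x)"
      by (metis add.commute comp_apply funpow_add)
    ultimately show False using x least[OF that] by simp
  qed
  then show ?thesis using n x by (auto simp: has_period_def comm)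
qed

lemma has_period_iterate: "has_period g n x \<Longrightarrow> has_period g n ((g ^^ i) x)"
  by (induction i) (auto intro: has_period_step)

text \<open>
  The basin of \<open>x\<close> is pulled back along \<open>g\<^sup>n\<^sup>-\<^sup>i\<close> to a neighbourhood of \<open>g\<^sup>i x\<close>, and the convergence is
  pushed forward by \<open>g\<^sup>i\<close>.
\<close>

lemma attracting_fixed_point_iterate:
  fixes g :: "'a::metric_space \<Rightarrow> 'a"
  assumes cont: "continuous_on UNIV g" and attr: "attracting_fixed_point (g ^^ n) x" and "i \<le> n"
  shows "attracting_fixed_point (g ^^ n) ((g ^^ i) x)"
proof -
  obtain V where V: "open V" "x \<in> V" and x: "(g ^^ n) x = x"
    and unif: "uniform_limit V (\<lambda>k. (g ^^ n) ^^ k) (\<lambda>_. x) sequentially"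
    using attr unfolding attracting_fixed_point_def by blast
  have cont_iter: "continuous_on UNIV (g ^^ m)" for m
  proof (induction m)
    case (Suc m)
    then show ?case using continuous_on_compose2[OF cont Suc] by (simp add: o_def)
  qed (simp add: id_def)
  define W where "W = (g ^^ (n - i)) -` V"
  have "open W" unfolding W_def using V(1) cont_iter by (rule open_vimage)
  moreover have "(g ^^ i) x \<in> W"
    using V(2) x \<open>i \<le> n\<close> funpow_add[of "n - i" i g] by (simp add: W_def)
  moreover have "uniform_limit W (\<lambda>k. (g ^^ n) ^^ k) (\<lambda>_. (g ^^ i) x) sequentially"
    unfolding uniform_limit_iff
  proof (intro allI impI)
    fix e :: real assume "e > 0"
    have "isCont (g ^^ i) x" using cont_iter by (simp add: continuous_on_eq_continuous_at)
    then obtain d where d: "d > 0" "\<And>y. dist y x < d \<Longrightarrow> dist ((g ^^ i) y) ((g ^^ i) x) < e"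
      using \<open>e > 0\<close> unfolding continuous_at_eps_delta by blast
    obtain K where K: "\<And>k y. k \<ge> K \<Longrightarrow> y \<in> V \<Longrightarrow> dist (((g ^^ n) ^^ k) y) x < d"
      using unif d(1) unfolding uniform_limit_iff eventually_sequentially by blast
    have "dist (((g ^^ n) ^^ k) c) ((g ^^ i) x) < e" if k: "k \<ge> Suc K" and c: "c \<in> W" for k c
    proof -
      obtain k' where k': "k = Suc k'" "k' \<ge> K" using k by (cases k) auto
      have "((g ^^ n) ^^ k) c = (g ^^ (i + (n * k' + (n - i)))) c"
        using \<open>i \<le> n\<close> by (simp add: k' funpow_mult add.commute)
      also have "\<dots> = (g ^^ i) (((g ^^ n) ^^ k') ((g ^^ (n - i)) c))"
        by (simp only: funpow_add o_apply funpow_mult)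
      finally show ?thesis using d(2) K[OF k'(2)] c by (simp add: W_def)
    qed
    then show "\<forall>\<^sub>F k in sequentially. \<forall>c\<in>W. dist (((g ^^ n) ^^ k) c) ((g ^^ i) x) < e"
      unfolding eventually_sequentially by blast
  qed
  moreover have "(g ^^ n) ((g ^^ i) x) = (g ^^ i) x"
    by (metis x add.commute comp_apply funpow_add)
  ultimately show ?thesis unfolding attracting_fixed_point_def by blast
qed

lemma attracting_cycle_orbit:
  fixes g :: "'a::metric_space \<Rightarrow> 'a"
  assumes "continuous_on UNIV g" "has_period g n x" "attracting_fixed_point (g ^^ n) x"
  shows "attracting_cycle g ((\<lambda>i. (g ^^ i) x) ` {..<n})"
  unfolding attracting_cycle_def
proof (intro exI conjI)
  show "\<forall>y\<in>(\<lambda>i. (g ^^ i) x) ` {..<n}. attracting_fixed_point (g ^^ n) y"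
    using attracting_fixed_point_iterate[OF assms(1,3)] by simp
qed (use assms in simp_all)

lemma continuous_f: "continuous_on UNIV (f \<alpha> b)"
proof -
  obtain a where a: "\<alpha> = to_circle a" by (rule to_circle_exhaust)
  have Lip: "dist (f \<alpha> b c) (f \<alpha> b d) \<le> (2 + 2 * \<bar>b\<bar>) * dist c d" for c d
  proof -
    obtain x where d: "d = to_circle x" by (rule to_circle_exhaust)
    obtain y where c: "c = to_circle y" "\<bar>y - x\<bar> = dist c (to_circle x)" by (rule nearest_lift)
    have "dist (f \<alpha> b c) (f \<alpha> b d) \<le> \<bar>F a b y - F a b x\<bar>"
      unfolding a c d f_to_circle by (rule dist_to_circle_le)
    also have "\<dots> = \<bar>2 * (y - x) + b / 2 * (S y - S x)\<bar>" by (simp add: F_def algebra_simps diff_divide_distrib)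
    also have "\<dots> \<le> \<bar>2 * (y - x)\<bar> + \<bar>b / 2\<bar> * \<bar>S y - S x\<bar>"
      using abs_triangle_ineq[of "2 * (y - x)" "b / 2 * (S y - S x)"] by (simp add: abs_mult)
    also have "\<dots> \<le> \<bar>2 * (y - x)\<bar> + \<bar>b / 2\<bar> * (4 * \<bar>y - x\<bar>)"
      using S_Lipschitz by (intro add_left_mono mult_left_mono) auto
    also have "\<dots> = (2 + 2 * \<bar>b\<bar>) * dist c d" using c d by (simp add: abs_mult algebra_simps)
    finally show ?thesis .
  qed
  have "(2 + 2 * \<bar>b\<bar>)-lipschitz_on UNIV (f \<alpha> b)" using Lip by (simp add: lipschitz_on_def)
  then show ?thesis by (rule lipschitz_on_continuous_on)
qed

section \<open>Tongues\<close>

text \<open>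
  On \<open>[1/2, v]\<close> the graph of the return map starts above and ends below the diagonal. These two open
  conditions turn out to describe the hyperbolic parameters whose attracting cycle has period \<open>n\<close>
  and combinatorics \<open>\<theta>\<close>. The bound \<open>v \<le> 1\<close> keeps the attracting point in \<open>I_minus\<close>.
\<close>

definition tongue :: "real \<Rightarrow> real \<Rightarrow> nat \<Rightarrow> real \<Rightarrow> bool"
  where "tongue a b n \<theta> \<longleftrightarrow> doubling_period n \<theta> \<and> 1/2 < ret a b n \<theta> (1/2) \<and>
    (\<exists>v. 1/2 < v \<and> v \<le> 1 \<and> ret a b n \<theta> v < v)"

lemma doubling_periodD:
  assumes "doubling_period n \<theta>" shows "n \<ge> 1" "(2 ^ n - 1) * \<theta> \<in> \<int>"
  using assms by (auto simp: doubling_period_def)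

lemma semiconj_eq_between:
  assumes "0 \<le> b" "b < 1" "semiconj a b u = \<theta>" "semiconj a b v = \<theta>" "u \<le> x" "x \<le> v"
  shows "semiconj a b x = \<theta>"
  using semiconj_mono[OF assms(1,2,5), of a] semiconj_mono[OF assms(1,2,6), of a] assms(3,4) by simp

text \<open>
  An interior point whose orbit hit a half-integer would land, modulo 1, on \<open>1/2\<close>, which is a
  different point of the same fibre.
\<close>

lemma ret_convex_from_half:
  assumes b: "0 \<le> b" "b < 1" and per: "doubling_period n \<theta>"
    and h: "semiconj a b (1/2) = \<theta>" "semiconj a b v = \<theta>" and v: "1/2 < v"
  shows "convex_on {1/2..v} (ret a b n \<theta>)"
proof (rule ret_convex_on[OF b v])
  fix i z assume i: "i < n" and z: "1/2 < z" "z < v"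
  have "semiconj a b z = \<theta>" using semiconj_eq_between[OF b h] z by simp
  then show "(F a b ^^ i) z - 1/2 \<notin> \<int>"
    using fiber_hits_once[OF b per _ h(1) i, of z 0] doubling_periodD[OF per] z by auto
qed

lemma ret_convex_from_half_trapped:
  assumes b: "0 \<le> b" "b < 1" and per: "doubling_period n \<theta>"
    and "1/2 \<le> ret a b n \<theta> (1/2)" "ret a b n \<theta> v \<le> v" "1/2 < v"
  shows "convex_on {1/2..v} (ret a b n \<theta>)"
  using assms(4-6) semiconj_eq_on_trapped[OF b doubling_periodD[OF per], of "1/2" a v]
  by (intro ret_convex_from_half b per) auto

lemma ret_fixed_point_between:
  assumes "u \<le> v" "(u \<le> ret a b n \<theta> u \<and> ret a b n \<theta> v \<le> v) \<or> (ret a b n \<theta> u \<le> u \<and> v \<le> ret a b n \<theta> v)"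
  obtains x where "u \<le> x" "x \<le> v" "ret a b n \<theta> x = x"
proof -
  have "continuous_on {u..v} (\<lambda>x. ret a b n \<theta> x - x)" by (intro continuous_intros continuous_ret)
  then have "\<exists>x\<ge>u. x \<le> v \<and> ret a b n \<theta> x - x = 0"
    using IVT'[of "\<lambda>x. ret a b n \<theta> x - x" u 0 v] IVT2'[of "\<lambda>x. ret a b n \<theta> x - x" v 0 u] assms
    by auto
  then show ?thesis using that by auto
qed

text \<open>
  A convex function that starts strictly above the diagonal and ends strictly below it meets the
  diagonal once.
\<close>

lemma unique_crossing:
  assumes b: "0 \<le> b" "b < 1" and per: "doubling_period n \<theta>"
    and left: "1/2 < ret a b n \<theta> (1/2)" and right: "ret a b n \<theta> v < v" and v: "1/2 < v"
  obtains x where "1/2 < x" "x < v" "ret a b n \<theta> x = x"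
    "\<And>z. 1/2 \<le> z \<Longrightarrow> z < x \<Longrightarrow> z < ret a b n \<theta> z"
    "\<And>z. x < z \<Longrightarrow> z \<le> v \<Longrightarrow> ret a b n \<theta> z < z"
proof -
  obtain x where x: "1/2 \<le> x" "x \<le> v" "ret a b n \<theta> x = x"
    using ret_fixed_point_between[of "1/2" v a b n \<theta>] left right v by auto
  have "x \<noteq> 1/2" "x \<noteq> v" using left right x(3) by (metis less_irrefl)+
  with x have x_less: "1/2 < x" "x < v" by simp_all
  have conv: "convex_on {1/2..v} (ret a b n \<theta>)"
    using ret_convex_from_half_trapped[OF b per _ _ v] left right by simp
  show ?thesis
  proof (rule that[OF x_less x(3)])
    fix z assume z: "1/2 \<le> z" "z < x"
    show "z < ret a b n \<theta> z"
    proof (rule ccontr)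
      assume "\<not> z < ret a b n \<theta> z"
      moreover have "convex_on {z..v} (ret a b n \<theta>)"
        using convex_on_subset[OF conv] z by auto
      ultimately have "ret a b n \<theta> x < x"
        using convex_on_less_diagonal[of z v _ x] z x_less right by auto
      with x show False by simp
    qed
  next
    fix z assume z: "x < z" "z \<le> v"
    have "convex_on {x..v} (ret a b n \<theta>)"
      using convex_on_subset[OF conv] x_less by auto
    then show "ret a b n \<theta> z < z"
      using convex_on_less_diagonal[of x v "ret a b n \<theta>" z] z x right by (cases "z = v") auto
  qed
qed

lemma semiconj_fixed:
  assumes "0 \<le> b" "b < 1" "doubling_period n \<theta>" "ret a b n \<theta> x = x"
  shows "semiconj a b x = \<theta>"
  using semiconj_eq_on_trapped[OF assms(1,2) doubling_periodD[OF assms(3)], of x a x x] assms(4) by simp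

lemma has_period_if_ret_fixed:
  assumes b: "0 \<le> b" "b < 1" and per: "doubling_period n \<theta>" and x: "ret a b n \<theta> x = x"
  shows "has_period (f (to_circle a) b) n (to_circle x)"
  unfolding has_period_def
proof (intro conjI allI impI notI)
  show "n \<ge> 1" using doubling_periodD[OF per] by simp
  show "(f (to_circle a) b ^^ n) (to_circle x) = to_circle x"
    using to_circle_ret[OF doubling_periodD(2)[OF per], of a b x] x by simp
  fix m assume m: "1 \<le> m \<and> m < n" and "(f (to_circle a) b ^^ m) (to_circle x) = to_circle x"
  then have "(F a b ^^ m) x - x \<in> \<int>" by (simp add: f_iterate_to_circle to_circle_eq_iff)
  then obtain j where "(F a b ^^ m) x - x = of_int j" by (elim Ints_cases)
  then have "(F a b ^^ m) x = x + of_int j" by simp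
  then have "2 ^ m * semiconj a b x = semiconj a b x + of_int j" using semiconj_F_iterate semiconj_shift by metis
  then have "(2 ^ m - 1) * \<theta> = of_int j" unfolding semiconj_fixed[OF b per x] by (simp add: algebra_simps)
  then have "(2 ^ m - 1) * \<theta> \<in> \<int>" by simp
  then show False using per m by (auto simp: doubling_period_def)
qed

lemma attracting_cycle_if_crossing:
  assumes b: "0 \<le> b" "b < 1" and per: "doubling_period n \<theta>"
    and "u < x" "x < v" and x: "ret a b n \<theta> x = x"
    and "\<And>z. u \<le> z \<Longrightarrow> z < x \<Longrightarrow> z < ret a b n \<theta> z"
    and "\<And>z. x < z \<Longrightarrow> z \<le> v \<Longrightarrow> ret a b n \<theta> z < z"
  obtains C where "attracting_cycle (f (to_circle a) b) C" "to_circle x \<in> C"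
proof
  let ?g = "f (to_circle a) b"
  have "attracting_fixed_point (?g ^^ n) (to_circle x)"
    by (rule attracting_fixed_point_if_crossing[where G = "ret a b n \<theta>"])
      (use assms to_circle_ret[OF doubling_periodD(2)[OF per]] strict_mono_mono[OF ret_strict_mono[OF b]]
        continuous_ret in auto)
  then show "attracting_cycle ?g ((\<lambda>i. (?g ^^ i) (to_circle x)) ` {..<n})"
    using attracting_cycle_orbit[OF continuous_f has_period_if_ret_fixed[OF b per x]] by simp
  show "to_circle x \<in> (\<lambda>i. (?g ^^ i) (to_circle x)) ` {..<n}"
    using doubling_periodD(1)[OF per] by (intro image_eqI[of _ _ 0]) auto
qed

lemma strict_mono_periodic_fixed:
  fixes A :: "real \<Rightarrow> real"
  assumes "strict_mono A" "(A ^^ n) p = p" "n \<ge> 1" shows "A p = p"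
proof (rule ccontr)
  assume "A p \<noteq> p"
  then consider "A p > p" | "A p < p" by linarith
  then show False
  proof cases
    case 1
    have "(A ^^ Suc k) p > p" for k
    proof (induction k)
      case (Suc k)
      then have "A p < A ((A ^^ Suc k) p)" using assms(1) by (simp add: strict_mono_less)
      with 1 show ?case by simp
    qed (use 1 in simp)
    then show False using assms(2,3) by (metis One_nat_def Suc_le_D less_irrefl)
  next
    case 2
    have "(A ^^ Suc k) p < p" for k
    proof (induction k)
      case (Suc k)
      then have "A ((A ^^ Suc k) p) < A p" using assms(1) by (simp add: strict_mono_less)
      with 2 show ?case by simp
    qed (use 2 in simp)
    then show False using assms(2,3) by (metis One_nat_def Suc_le_D less_irrefl)
  qed
qed

text \<open>
  The exact period of a point is inherited by its image under \<open>semiconj\<close>, although \<open>semiconj\<close> is not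
  injective: if the image had a smaller period \<open>i\<close>, then the matching lift \<open>A\<close> of the \<open>i\<close>-th iterate
  would permute the points of the cycle that lie in one fibre. An increasing map has no periodic
  points besides its fixed points, so \<open>A\<close> would fix \<open>p\<close>.
\<close>

lemma doubling_period_semiconj:
  assumes b: "0 \<le> b" "b < 1" and per: "has_period (f (to_circle a) b) n (to_circle p)"
  shows "doubling_period n (semiconj a b p)" "ret a b n (semiconj a b p) p = p"
proof -
  let ?\<theta> = "semiconj a b p"
  have n: "n \<ge> 1" and p: "(f (to_circle a) b ^^ n) (to_circle p) = to_circle p"
    and least: "\<And>m. 1 \<le> m \<Longrightarrow> m < n \<Longrightarrow> (f (to_circle a) b ^^ m) (to_circle p) \<noteq> to_circle p"
    using per by (auto simp: has_period_def)
  have "(F a b ^^ n) p - p \<in> \<int>" using p by (simp add: f_iterate_to_circle to_circle_eq_iff)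
  then obtain j where "(F a b ^^ n) p - p = of_int j" by (elim Ints_cases)
  then have j: "(F a b ^^ n) p = p + of_int j" by simp
  then have "2 ^ n * ?\<theta> = ?\<theta> + of_int j" using semiconj_F_iterate semiconj_shift by metis
  then have \<theta>: "(2 ^ n - 1) * ?\<theta> = of_int j" by (simp add: algebra_simps)
  then show "ret a b n ?\<theta> p = p" by (simp add: ret_def j)
  have "(2 ^ i - 1) * ?\<theta> \<notin> \<int>" if i: "0 < i" "i < n" for i
  proof
    assume "(2 ^ i - 1) * ?\<theta> \<in> \<int>"
    then obtain k where k: "(2 ^ i - 1) * ?\<theta> = of_int k" by (elim Ints_cases)
    define A where "A x = (F a b ^^ i) x + of_int (- k)" for x
    have A_mono: "strict_mono A"
      using F_iterate_strict_mono[OF b] by (simp add: A_def strict_mono_def)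
    have h_A: "semiconj a b (A x) = ?\<theta>" if "semiconj a b x = ?\<theta>" for x
      unfolding A_def semiconj_shift semiconj_F_iterate that using k by (simp add: algebra_simps)
    have A_iter: "semiconj a b ((A ^^ m) p) = ?\<theta> \<and>
      to_circle ((A ^^ m) p) = (f (to_circle a) b ^^ (i * m)) (to_circle p)" for m
    proof (induction m)
      case (Suc m)
      have "to_circle (A x) = (f (to_circle a) b ^^ i) (to_circle x)" for x
        by (simp add: A_def f_iterate_to_circle to_circle_eq_iff)
      then show ?case using Suc h_A by (simp add: funpow_add)
    qed simp
    have "to_circle ((A ^^ n) p) = to_circle p"
      using A_iter[of n] funpow_fixed[OF p, of i] by (simp add: mult.commute)
    then have "(A ^^ n) p - p \<in> \<int>" by (simp add: to_circle_eq_iff)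
    then obtain l where "(A ^^ n) p - p = of_int l" by (elim Ints_cases)
    then have l: "(A ^^ n) p = p + of_int l" by simp
    then have "?\<theta> = ?\<theta> + of_int l" using A_iter[of n] semiconj_shift by metis
    with l have "(A ^^ n) p = p" by simp
    then have "A p = p" using A_mono n by (intro strict_mono_periodic_fixed)
    then have "(f (to_circle a) b ^^ i) (to_circle p) = to_circle p" using A_iter[of 1] by simp
    with least i show False by simp
  qed
  with n \<theta> show "doubling_period n ?\<theta>" by (auto simp: doubling_period_def)
qed

text \<open>
  The return map sends \<open>p - 1\<close> to \<open>p - 2\<^sup>n\<close> and \<open>p + 1\<close> to \<open>p + 2\<^sup>n\<close>, that is, away from \<open>p\<close>, whereas
  it moves points close to \<open>p\<close> towards \<open>p\<close>. So there is a fixed point in between on either side.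
\<close>

lemma fiber_of_attracting:
  assumes b: "0 \<le> b" "b < 1" and per: "has_period (f (to_circle a) b) n (to_circle p)"
    and attr: "attracting_fixed_point (f (to_circle a) b ^^ n) (to_circle p)"
    and \<theta>: "\<theta> = semiconj a b p"
  obtains l r e where "l < p" "p < r" "ret a b n \<theta> l = l" "ret a b n \<theta> r = r" "e > 0"
    "\<And>z. p - e < z \<Longrightarrow> z < p \<Longrightarrow> z < ret a b n \<theta> z"
    "\<And>z. p < z \<Longrightarrow> z < p + e \<Longrightarrow> ret a b n \<theta> z < z"
proof -
  let ?G = "ret a b n \<theta>"
  have dp: "doubling_period n \<theta>" and p: "?G p = p"
    using doubling_period_semiconj[OF b per] \<theta> by auto
  obtain e where e: "e > 0" "\<And>z. p - e < z \<Longrightarrow> z < p \<Longrightarrow> z < ?G z"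
      "\<And>z. p < z \<Longrightarrow> z < p + e \<Longrightarrow> ?G z < z"
    using crossing_if_attracting_fixed_point[OF to_circle_ret[OF doubling_periodD(2)[OF dp]]
        strict_mono_mono[OF ret_strict_mono[OF b]] continuous_ret p attr] by blast
  have pow: "(2::real) ^ n > 1" using two_power_gt_1 doubling_periodD[OF dp] by blast
  have shift: "?G (p + of_int j) = p + 2 ^ n * of_int j" for j
    using p unfolding ret_def F_iterate_shift by simp
  define d where "d = min e 1 / 2"
  have d: "0 < d" "d < e" "d < 1" using e(1) by (auto simp: d_def)
  have "?G (p - 1) \<le> p - 1" "p - d \<le> ?G (p - d)"
    using shift[of "-1"] pow e(2)[of "p - d"] d by simp_all
  then obtain l where l: "l \<le> p - d" "?G l = l"
    using ret_fixed_point_between[of "p - 1" "p - d" a b n \<theta>] d by auto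
  have "p + 1 \<le> ?G (p + 1)" "?G (p + d) \<le> p + d"
    using shift[of 1] pow e(3)[of "p + d"] d by simp_all
  then obtain r where r: "p + d \<le> r" "?G r = r"
    using ret_fixed_point_between[of "p + d" "p + 1" a b n \<theta>] d by auto
  show ?thesis using that[of l r e] l r e d by auto
qed

text \<open>
  The return map fixes \<open>l < p\<close> and \<open>p\<close> and lies above the diagonal just to the left of \<open>p\<close>, so it is
  not convex on \<open>[l, p]\<close>, and some point in between must visit \<open>1/2\<close>. Iterating up to this visit
  replaces \<open>p\<close> by the point of the cycle whose fibre contains \<open>1/2\<close>.
\<close>

lemma tongue_if_attracting_cycle:
  assumes b: "0 \<le> b" "b < 1" and C: "attracting_cycle (f (to_circle a) b) C"
  obtains n \<theta> where "tongue a b n \<theta>"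
proof -
  let ?g = "f (to_circle a) b"
  obtain n y where y: "has_period ?g n y" and C_eq: "C = (\<lambda>i. (?g ^^ i) y) ` {..<n}"
    and attr: "\<And>y. y \<in> C \<Longrightarrow> attracting_fixed_point (?g ^^ n) y"
    using C unfolding attracting_cycle_def by blast
  have n: "n \<ge> 1" using y by (simp add: has_period_def)
  obtain p0 where p0: "y = to_circle p0" by (rule to_circle_exhaust)
  define \<theta>0 where "\<theta>0 = semiconj a b p0"
  have per0: "has_period ?g n (to_circle p0)" using y p0 by simp
  have "y \<in> C" using n unfolding C_eq by (intro image_eqI[of _ _ 0]) auto
  then have "attracting_fixed_point (?g ^^ n) (to_circle p0)" using attr p0 by simp
  then obtain l r0 e0 where l: "l < p0" and "p0 < r0" and l': "ret a b n \<theta>0 l = l"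
    and "ret a b n \<theta>0 r0 = r0" and e0: "e0 > 0"
    "\<And>z. p0 - e0 < z \<Longrightarrow> z < p0 \<Longrightarrow> z < ret a b n \<theta>0 z"
    and "\<And>z. p0 < z \<Longrightarrow> z < p0 + e0 \<Longrightarrow> ret a b n \<theta>0 z < z"
    using fiber_of_attracting[OF b per0 _ \<theta>0_def] by blast
  note l = l l'
  have dp0: "doubling_period n \<theta>0" and fix0: "ret a b n \<theta>0 p0 = p0"
    using doubling_period_semiconj[OF b per0] \<theta>0_def by auto
  have "\<exists>i z. i < n \<and> l < z \<and> z < p0 \<and> (F a b ^^ i) z - 1/2 \<in> \<int>"
  proof (rule ccontr)
    assume "\<not> ?thesis"
    then have "convex_on {l..p0} (ret a b n \<theta>0)" using l by (intro ret_convex_on[OF b]) auto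
    moreover define z where "z = max ((l + p0) / 2) (p0 - e0 / 2)"
    then have z: "l < z" "z < p0" "p0 - e0 < z" using l e0(1) by (auto simp: max_def)
    ultimately have "ret a b n \<theta>0 z \<le> z"
      using convex_on_le_diagonal[of l p0 _ z] l fix0 by auto
    with e0(2)[OF z(3,2)] show False by simp
  qed
  then obtain i z k where i: "i < n" and z: "l < z" "z < p0" and k: "(F a b ^^ i) z - 1/2 = of_int k"
    by (meson Ints_cases)
  define p where "p = (F a b ^^ i) p0 + of_int (- k)"
  define \<theta> where "\<theta> = semiconj a b p"
  have half: "1/2 = (F a b ^^ i) z + of_int (- k)" using k by simp
  have "semiconj a b z = \<theta>0"
    using semiconj_eq_between[OF b semiconj_fixed[OF b dp0 l(2)] semiconj_fixed[OF b dp0 fix0], of z] z by simp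
  then have h_half: "semiconj a b (1/2) = \<theta>"
    unfolding half \<theta>_def p_def semiconj_shift semiconj_F_iterate \<theta>0_def by simp
  have p_half: "1/2 < p"
    unfolding half p_def using F_iterate_strict_mono[OF b] z by (simp add: strict_mono_less)
  have to_p: "to_circle p = (?g ^^ i) y"
    by (simp add: p_def p0 f_iterate_to_circle to_circle_eq_iff)
  have per: "has_period ?g n (to_circle p)" using has_period_iterate[OF y] to_p by simp
  have "attracting_fixed_point (?g ^^ n) (to_circle p)" using attr C_eq i to_p by auto
  then obtain l1 r e where "l1 < p" and r: "p < r" and "ret a b n \<theta> l1 = l1"
    and r': "ret a b n \<theta> r = r" and e: "e > 0"
    "\<And>z. p - e < z \<Longrightarrow> z < p \<Longrightarrow> z < ret a b n \<theta> z"
    "\<And>z. p < z \<Longrightarrow> z < p + e \<Longrightarrow> ret a b n \<theta> z < z"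
    using fiber_of_attracting[OF b per _ \<theta>_def] by blast
  note r = r r'
  have dp: "doubling_period n \<theta>" and fp: "ret a b n \<theta> p = p"
    using doubling_period_semiconj[OF b per] \<theta>_def by auto
  have h_r: "semiconj a b r = \<theta>" using semiconj_fixed[OF b dp r(2)] .
  (* Otherwise convexity would push the graph below the diagonal on all of [1/2, p]. *)
  have left: "1/2 < ret a b n \<theta> (1/2)"
  proof (rule ccontr)
    assume not: "\<not> ?thesis"
    have "convex_on {1/2..p} (ret a b n \<theta>)"
      using ret_convex_from_half[OF b dp h_half _ p_half] \<theta>_def by simp
    moreover define z where "z = max ((1/2 + p) / 2) (p - e / 2)"
    then have z: "1/2 < z" "z < p" "p - e < z" using p_half e(1) by (auto simp: max_def)
    ultimately have "ret a b n \<theta> z \<le> z"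
      using convex_on_le_diagonal[of "1/2" p _ z] not fp by auto
    with e(2)[OF z(3,2)] show False by simp
  qed
  (* Otherwise the fibre contains the integer 1 to the left of r and not to the right of p. No other
     point of the fibre visits an integer, so the return map is concave on [p, r], which contradicts
     its lying below the diagonal just to the right of p. *)
  have p_less: "p < 1"
  proof (rule ccontr)
    assume not: "\<not> ?thesis"
    have h_between: "semiconj a b z = \<theta>" if "1/2 \<le> z" "z \<le> r" for z
      using semiconj_eq_between[OF b h_half h_r that] .
    have "concave_on {p..r} (ret a b n \<theta>)"
    proof (rule ret_concave_on[OF b r(1)])
      fix i z assume "i < n" and z: "p < z" "z < r"
      show "(F a b ^^ i) z \<notin> \<int>"
      proof
        assume "(F a b ^^ i) z \<in> \<int>"
        then have "(F a b ^^ i) z - (F a b ^^ 0) 1 \<in> \<int>" by simp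
        then have "z = 1"
          using n not r z p_half \<open>i < n\<close>
          by (intro fiber_hits_once[OF b dp h_between h_between, where i = i and k = 0]) auto
        with z not show False by simp
      qed
    qed
    moreover define z where "z = min ((p + r) / 2) (p + e / 2)"
    then have z: "p < z" "z < r" "z < p + e" using r e(1) by (auto simp: min_def)
    ultimately have "z \<le> ret a b n \<theta> z"
      using concave_on_ge_diagonal[of p r _ z] r fp by auto
    with e(3)[OF z(1,3)] show False by simp
  qed
  define v where "v = min 1 (p + e / 2)"
  have "1/2 < v" "v \<le> 1" "p < v" "v < p + e" using p_half p_less e(1) by (auto simp: v_def min_def)
  then have "tongue a b n \<theta>" unfolding tongue_def using dp left e(3)[of v] by blast
  then show ?thesis by (rule that)
qed

lemma tongueE:
  assumes "tongue a b n \<theta>"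
  obtains v where "doubling_period n \<theta>" "1/2 < ret a b n \<theta> (1/2)" "1/2 < v" "v \<le> 1" "ret a b n \<theta> v < v"
  using assms by (auto simp: tongue_def)

lemma hyperbolic_if_tongue:
  assumes "0 \<le> b" "b < 1" "tongue a b n \<theta>" shows "(to_circle a, b) \<in> hyperbolic_params"
  using assms(3)
proof (rule tongueE)
  fix v assume v: "doubling_period n \<theta>" "1/2 < ret a b n \<theta> (1/2)" "1/2 < v" "v \<le> 1" "ret a b n \<theta> v < v"
  obtain x where "1/2 < x" "x < v" "ret a b n \<theta> x = x"
    "\<And>z. 1/2 \<le> z \<Longrightarrow> z < x \<Longrightarrow> z < ret a b n \<theta> z"
    "\<And>z. x < z \<Longrightarrow> z \<le> v \<Longrightarrow> ret a b n \<theta> z < z"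
    using unique_crossing[OF assms(1,2) v(1,2,5,3)] by blast
  then obtain C where "attracting_cycle (f (to_circle a) b) C"
    using attracting_cycle_if_crossing[OF assms(1,2) v(1), of "1/2" x v a] by blast
  then show ?thesis using assms(1,2) by (auto simp: hyperbolic_params_def)
qed

lemma tongue_if_hyperbolic:
  assumes "(to_circle a, b) \<in> hyperbolic_params"
  obtains n \<theta> where "0 \<le> b" "b < 1" "tongue a b n \<theta>"
proof -
  obtain C where "0 \<le> b" "b < 1" "attracting_cycle (f (to_circle a) b) C"
    using assms by (auto simp: hyperbolic_params_def)
  then show ?thesis using tongue_if_attracting_cycle that by metis
qed

lemma F_iterate_linear: "(F a 0 ^^ n) y - (F a 0 ^^ n) x = 2 ^ n * (y - x)"
proof (induction n)
  case (Suc n)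
  then show ?case unfolding F_iterate_Suc by (simp add: algebra_simps)
qed simp

text \<open>
  For \<open>b = 0\<close> the map is expanding. Therefore the edge \<open>b = 0\<close> of the parameter strip contains no
  hyperbolic parameters, and the hyperbolic parameters are open in the product of the circle and
  the line.
\<close>

lemma tongue_b_nonzero: assumes "tongue a b n \<theta>" shows "b \<noteq> 0"
proof
  assume "b = 0"
  obtain v where v: "doubling_period n \<theta>" "1/2 < ret a b n \<theta> (1/2)" "1/2 < v" "ret a b n \<theta> v < v"
    using assms by (auto simp: tongue_def)
  then have "2 ^ n * (v - 1/2) < 1 * (v - 1/2)"
    unfolding F_iterate_linear[of n a v "1/2", symmetric] \<open>b = 0\<close> ret_def by simp
  moreover have "1 * (v - 1/2) \<le> 2 ^ n * (v - 1/2)"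
    using v by (intro mult_right_mono) auto
  ultimately show False by simp
qed

text \<open>
  Different lifts of the same circle parameter give the same return map with a shifted \<open>\<theta>\<close>, and hence
  the same period.
\<close>

lemma ret_param_shift: "ret (a + of_int j) b n (\<theta> + of_int j) x = ret a b n \<theta> x"
  unfolding ret_def F_iterate_param_shift by (simp add: algebra_simps)

lemma tongue_param_shift:
  assumes "tongue a b n \<theta>" shows "tongue (a + of_int j) b n (\<theta> + of_int j)"
proof -
  have "(2 ^ i - 1) * (\<theta> + of_int j) \<in> \<int> \<longleftrightarrow> (2 ^ i - 1) * \<theta> \<in> \<int>" for i
  proof -
    have "(2 ^ i - 1) * (\<theta> + of_int j) = (2 ^ i - 1) * \<theta> + of_int ((2 ^ i - 1) * j)"
      by (simp add: algebra_simps)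
    then show ?thesis by (metis Ints_of_int add_in_Ints_iff_right)
  qed
  with assms show ?thesis by (simp add: tongue_def doubling_period_def ret_param_shift)
qed

text \<open>
  The interval \<open>[1/2, v]\<close> is trapped, so \<open>\<theta>\<close> is the value of the semiconjugacy at \<open>1/2\<close>, whose exact
  period under doubling is \<open>n\<close>.
\<close>

lemma tongue_unique:
  assumes b: "0 \<le> b" "b < 1" and t: "tongue a b n \<theta>" "tongue a b m \<eta>"
  shows "n = m" "\<theta> = \<eta>"
proof -
  have h_half: "semiconj a b (1/2) = \<theta>" if "tongue a b n \<theta>" for n \<theta>
  proof -
    obtain v where v: "doubling_period n \<theta>" "1/2 < ret a b n \<theta> (1/2)" "1/2 < v" "ret a b n \<theta> v < v"
      using \<open>tongue a b n \<theta>\<close> by (auto simp: tongue_def)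
    then show ?thesis using semiconj_eq_on_trapped[OF b doubling_periodD[OF v(1)], of "1/2" a v "1/2"] by simp
  qed
  then show eq: "\<theta> = \<eta>" using t by metis
  have "\<not> n < m" if "doubling_period n \<theta>" "doubling_period m \<theta>" for n m
    using that by (auto simp: doubling_period_def)
  then show "n = m" using t eq by (metis nat_neq_iff tongue_def)
qed

lemma tongue_unique_circle:
  assumes b: "0 \<le> b" "b < 1" and t: "tongue a b n \<theta>" "tongue a' b m \<eta>" and eq: "to_circle a = to_circle a'"
  shows "n = m"
proof -
  obtain j where "a - a' = of_int j" using eq by (auto simp: to_circle_eq_iff elim: Ints_cases)
  then have "a = a' + of_int j" by simp
  then have "tongue a b m (\<eta> + of_int j)" using tongue_param_shift[OF t(2)] by simp
  then show ?thesis using tongue_unique(1)[OF b t(1)] by blast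
qed

lemma tendsto_ret_param:
  "((\<lambda>q. ret (fst q) (snd q) n \<theta> x) \<longlongrightarrow> ret a b n \<theta> x) (nhds (a, b))"
  unfolding ret_def by (intro tendsto_intros tendsto_F_iterate_param)

lemma eventually_tongue:
  assumes "tongue a b n \<theta>" shows "\<forall>\<^sub>F q in nhds (a, b). tongue (fst q) (snd q) n \<theta>"
proof -
  obtain v where v: "doubling_period n \<theta>" "1/2 < ret a b n \<theta> (1/2)" "1/2 < v" "v \<le> 1" "ret a b n \<theta> v < v"
    using assms by (auto simp: tongue_def)
  have lim: "((\<lambda>q. ret (fst q) (snd q) n \<theta> v - v) \<longlongrightarrow> ret a b n \<theta> v - v) (nhds (a, b))"
    by (intro tendsto_intros tendsto_ret_param)
  have "\<forall>\<^sub>F q in nhds (a, b). 1/2 < ret (fst q) (snd q) n \<theta> (1/2)"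
    using order_tendstoD(1)[OF tendsto_ret_param v(2)] .
  moreover have "\<forall>\<^sub>F q in nhds (a, b). ret (fst q) (snd q) n \<theta> v - v < 0"
    using order_tendstoD(2)[OF lim, of 0] v(5) by simp
  ultimately show ?thesis by eventually_elim (use v in \<open>auto simp: tongue_def\<close>)
qed

section \<open>Hyperbolic components\<close>

text \<open>
  A point of the circle near \<open>to_circle a\<close> has a lift at the same distance from \<open>a\<close>.
\<close>

lemma eventually_nhds_lift:
  fixes b :: real
  assumes "\<forall>\<^sub>F q in nhds (a, b). P (to_circle (fst q), snd q)"
  shows "\<forall>\<^sub>F q in nhds (to_circle a, b). P q"
proof -
  obtain d where d: "d > 0" "\<And>q. dist q (a, b) < d \<Longrightarrow> P (to_circle (fst q), snd q)"
    using assms unfolding eventually_nhds_metric by blast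
  have "P q" if near: "dist q (to_circle a, b) < d" for q
  proof -
    obtain \<alpha> b' where q: "q = (\<alpha>, b')" by (cases q)
    obtain a' where a': "\<alpha> = to_circle a'" "\<bar>a' - a\<bar> = dist \<alpha> (to_circle a)" by (rule nearest_lift)
    have "dist (a', b') (a, b) = dist q (to_circle a, b)"
      using a'(2) by (simp add: q dist_Pair_Pair dist_real_def)
    with near d(2)[of "(a', b')"] show ?thesis by (simp add: q a'(1))
  qed
  then show ?thesis unfolding eventually_nhds_metric using d(1) by blast
qed

lemma eventually_tongue_strip:
  assumes "0 \<le> b" "b < 1" "tongue a b n \<theta>"
  shows "\<forall>\<^sub>F q in nhds (a, b). 0 < snd q \<and> snd q < 1 \<and> tongue (fst q) (snd q) n \<theta>"
proof -
  have lim: "((\<lambda>q. snd q) \<longlongrightarrow> b) (nhds (a, b))"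
    using tendsto_snd[OF filterlim_ident[of "nhds (a, b)"]] by simp
  have "0 < b" using assms(1) tongue_b_nonzero[OF assms(3)] by simp
  then have "\<forall>\<^sub>F q in nhds (a, b). 0 < snd q" by (rule order_tendstoD(1)[OF lim])
  moreover have "\<forall>\<^sub>F q in nhds (a, b). snd q < 1"
    using assms(2) by (rule order_tendstoD(2)[OF lim])
  moreover note eventually_tongue[OF assms(3)]
  ultimately show ?thesis by eventually_elim simp
qed

text \<open>
  The image of a small ball of lifted parameters is connected and consists of hyperbolic parameters,
  hence stays inside the component.
\<close>

lemma component_eventually:
  assumes U: "U \<in> components hyperbolic_params" and q: "q \<in> U"
  shows "\<forall>\<^sub>F q' in nhds q. q' \<in> U"
proof -
  let ?\<pi> = "\<lambda>q. (to_circle (fst q), snd q) :: circle \<times> real"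
  obtain \<alpha> b where "q = (\<alpha>, b)" by (cases q)
  moreover obtain a where "\<alpha> = to_circle a" by (rule to_circle_exhaust)
  ultimately have q_eq: "q = (to_circle a, b)" by simp
  have "(to_circle a, b) \<in> hyperbolic_params" using in_components_subset[OF U] q q_eq by auto
  then obtain n \<theta> where t: "0 \<le> b" "b < 1" "tongue a b n \<theta>" by (rule tongue_if_hyperbolic)
  obtain d where d: "d > 0"
    "\<And>q'. dist q' (a, b) < d \<Longrightarrow> 0 < snd q' \<and> snd q' < 1 \<and> tongue (fst q') (snd q') n \<theta>"
    using eventually_tongue_strip[OF t] unfolding eventually_nhds_metric by blast
  have "?\<pi> q' \<in> hyperbolic_params" if "q' \<in> ball (a, b) d" for q'
    using d(2)[of q'] that hyperbolic_if_tongue[of "snd q'" "fst q'" n \<theta>] by (simp add: dist_commute)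
  then have "?\<pi> ` ball (a, b) d \<subseteq> hyperbolic_params" by blast
  moreover have "continuous_on A ?\<pi>" for A
    by (intro continuous_on_Pair continuous_on_snd continuous_on_id
        continuous_on_compose2[OF continuous_to_circle[of UNIV] continuous_on_fst[OF continuous_on_id]])
      simp
  then have "connected (?\<pi> ` ball (a, b) d)"
    by (intro connected_continuous_image convex_connected convex_ball)
  moreover have "?\<pi> (a, b) \<in> ?\<pi> ` ball (a, b) d" using d(1) by (intro imageI) simp
  with q q_eq have "U \<inter> ?\<pi> ` ball (a, b) d \<noteq> {}" by auto
  ultimately have sub: "?\<pi> ` ball (a, b) d \<subseteq> U" using components_maximal[OF U] by blast
  have "?\<pi> q' \<in> U" if "dist q' (a, b) < d" for q'
    using that sub by (auto simp: dist_commute image_subset_iff)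
  then have "\<forall>\<^sub>F q' in nhds (a, b). ?\<pi> q' \<in> U"
    unfolding eventually_nhds_metric using d(1) by blast
  then show ?thesis unfolding q_eq by (rule eventually_nhds_lift[where P = "\<lambda>q. q \<in> U"])
qed

lemma component_open:
  assumes "U \<in> components hyperbolic_params" shows "open U"
  unfolding open_subopen[of U]
proof
  fix q assume "q \<in> U"
  then obtain T where "open T" "q \<in> T" "\<forall>q'\<in>T. q' \<in> U"
    using component_eventually[OF assms] unfolding eventually_nhds by blast
  then show "\<exists>T. open T \<and> q \<in> T \<and> T \<subseteq> U" by blast
qed

text \<open>
  Distinct components are disjoint open sets, so none meets the closure of another.
\<close>

lemma frontier_not_hyperbolic:
  assumes U: "U \<in> components hyperbolic_params" and q: "q \<in> frontier U"
  shows "q \<notin> hyperbolic_params"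
proof
  assume "q \<in> hyperbolic_params"
  then obtain U' where U': "U' \<in> components hyperbolic_params" "q \<in> U'"
    using Union_components[of hyperbolic_params] by blast
  have "q \<in> closure U" "q \<notin> U"
    using q component_open[OF U] by (auto simp: frontier_def interior_open)
  then have "U' \<inter> U \<noteq> {}"
    using open_Int_closure_eq_empty[OF component_open[OF U'(1)], of U] U'(2) by blast
  then have "U' = U" using components_eq[OF U'(1) U] by blast
  with U'(2) \<open>q \<notin> U\<close> show False by simp
qed

text \<open>
  The period is well defined by \<open>tongue_unique_circle\<close> and locally constant.
\<close>

lemma component_period:
  assumes U: "U \<in> components hyperbolic_params"
  shows "\<exists>n. \<forall>a b. (to_circle a, b) \<in> U \<longrightarrow> (\<exists>\<theta>. tongue a b n \<theta>)"
proof -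
  define N where "N q = (SOME n. \<exists>a \<theta>. fst q = to_circle a \<and> tongue a (snd q) n \<theta>)"
    for q :: "circle \<times> real"
  have N: "N (to_circle a, b) = n" if "0 \<le> b" "b < 1" "tongue a b n \<theta>" for a b n \<theta>
  proof -
    have "\<exists>a' \<theta>'. to_circle a = to_circle a' \<and> tongue a' b n \<theta>'"
      using that(3) by blast
    then have "\<exists>a' \<theta>'. to_circle a = to_circle a' \<and> tongue a' b (N (to_circle a, b)) \<theta>'"
      unfolding N_def fst_conv snd_conv
      by (rule someI[where P = "\<lambda>n. \<exists>a' \<theta>'. to_circle a = to_circle a' \<and> tongue a' b n \<theta>'"])
    then obtain a' \<theta>' where "to_circle a = to_circle a'" "tongue a' b (N (to_circle a, b)) \<theta>'" by blast
    then show ?thesis using tongue_unique_circle[OF that] by simp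
  qed
  have "N constant_on U"
  proof (rule locally_constant_imp_constant)
    show "connected U" using U by (rule in_components_connected)
    fix q assume q: "q \<in> U"
    obtain \<alpha> b where "q = (\<alpha>, b)" by (cases q)
    moreover obtain a where "\<alpha> = to_circle a" by (rule to_circle_exhaust)
    ultimately have q_eq: "q = (to_circle a, b)" by simp
    have "(to_circle a, b) \<in> hyperbolic_params" using in_components_subset[OF U] q q_eq by auto
    then obtain n \<theta> where t: "0 \<le> b" "b < 1" "tongue a b n \<theta>" by (rule tongue_if_hyperbolic)
    have "\<forall>\<^sub>F q' in nhds (a, b). N (to_circle (fst q'), snd q') = n"
      using eventually_tongue_strip[OF t]
    proof eventually_elim
      case (elim q')
      then show ?case using N[of "snd q'" "fst q'" n \<theta>] by simp
    qed
    then have "\<forall>\<^sub>F q' in nhds q. N q' = n"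
      unfolding q_eq by (rule eventually_nhds_lift[where P = "\<lambda>q. N q = n"])
    then obtain T where T: "open T" "q \<in> T" "\<forall>q'\<in>T. N q' = n" unfolding eventually_nhds by blast
    show "\<exists>T. openin (top_of_set U) T \<and> q \<in> T \<and> (\<forall>q'\<in>T. N q' = N q)"
    proof (intro exI[of _ "U \<inter> T"] conjI)
      show "openin (top_of_set U) (U \<inter> T)" using T(1) by (rule openin_open_Int)
      show "q \<in> U \<inter> T" using q T(2) by simp
      show "\<forall>q'\<in>U \<inter> T. N q' = N q" using T by auto
    qed
  qed
  then obtain n where n: "\<forall>q\<in>U. N q = n" unfolding constant_on_def ..
  show ?thesis
  proof (intro exI[of _ n] allI impI)
    fix a b assume q: "(to_circle a, b) \<in> U"
    then have "(to_circle a, b) \<in> hyperbolic_params" using in_components_subset[OF U] by auto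
    then obtain n' \<theta> where t: "0 \<le> b" "b < 1" "tongue a b n' \<theta>" by (rule tongue_if_hyperbolic)
    have "n' = n" using N[OF t] n q by simp
    with t show "\<exists>\<theta>. tongue a b n \<theta>" by blast
  qed
qed

section \<open>The left boundary\<close>

text \<open>
  The attracting point in the fibre of \<open>1/2\<close>. As a limit along the orbit of \<open>1/2\<close> it is visibly
  independent of the lift of the parameter and needs no choice among the points of the cycle.
\<close>

definition half_limit :: "nat \<Rightarrow> circle \<times> real \<Rightarrow> circle"
  where "half_limit n q = lim (\<lambda>k. (f (fst q) (snd q) ^^ (n * k)) (to_circle (1/2)))"

text \<open>
  The point \<open>u\<close>, which moves to the right, and the point \<open>v\<close>, which moves to the left, enclose the
  attracting point. Taking them close to it gives continuity in the parameters, and taking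
  \<open>u = 1/2\<close> gives the behaviour at the boundary.
\<close>

lemma half_limit_between:
  assumes b: "0 \<le> b" "b < 1" and per: "doubling_period n \<theta>"
    and left: "1/2 < ret a b n \<theta> (1/2)" and "1/2 \<le> u" "u \<le> v" "1/2 < v"
    and u: "u < ret a b n \<theta> u" and v: "ret a b n \<theta> v < v"
  shows "\<exists>x C. 1/2 < x \<and> u \<le> x \<and> x < v \<and> ret a b n \<theta> x = x \<and>
    half_limit n (to_circle a, b) = to_circle x \<and>
    attracting_cycle (f (to_circle a) b) C \<and> to_circle x \<in> C"
proof -
  let ?G = "ret a b n \<theta>"
  obtain x where x: "1/2 < x" "x < v" "?G x = x"
    and above: "\<And>z. 1/2 \<le> z \<Longrightarrow> z < x \<Longrightarrow> z < ?G z"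
    and below: "\<And>z. x < z \<Longrightarrow> z \<le> v \<Longrightarrow> ?G z < z"
    using unique_crossing[OF b per left v \<open>1/2 < v\<close>] by blast
  have "u \<le> x" using below[of u] u \<open>u \<le> v\<close> by linarith
  obtain C where C: "attracting_cycle (f (to_circle a) b) C" "to_circle x \<in> C"
    using attracting_cycle_if_crossing[OF b per x(1,2,3) above below] by blast
  have "(\<lambda>k. (?G ^^ k) (1/2)) \<longlonglongrightarrow> x"
    using x above continuous_ret strict_mono_mono[OF ret_strict_mono[OF b]]
    by (intro iterates_increase_to) auto
  then have "(\<lambda>k. to_circle ((?G ^^ k) (1/2))) \<longlonglongrightarrow> to_circle x"
    using continuous_to_circle[of UNIV]
    by (intro isCont_tendsto_compose[of x to_circle]) (auto simp: continuous_on_eq_continuous_at)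
  moreover have "to_circle ((?G ^^ k) (1/2)) = (f (to_circle a) b ^^ (n * k)) (to_circle (1/2))" for k
    using iterate_to_circle[of ?G "f (to_circle a) b ^^ n" k "1/2"]
      to_circle_ret[OF doubling_periodD(2)[OF per]] by (simp add: funpow_mult)
  ultimately have "half_limit n (to_circle a, b) = to_circle x"
    by (simp add: half_limit_def limI)
  with x \<open>u \<le> x\<close> C show ?thesis by blast
qed

lemma attracting_branch_half_limit:
  assumes U: "U \<in> components hyperbolic_params"
    and n: "\<And>a b. (to_circle a, b) \<in> U \<Longrightarrow> \<exists>\<theta>. tongue a b n \<theta>"
  shows "attracting_branch U (half_limit n)"
  unfolding attracting_branch_def
proof (intro conjI)
  have b_range: "0 \<le> b \<and> b < 1" if "(\<alpha>, b) \<in> U" for \<alpha> b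
    using in_components_subset[OF U] that by (auto simp: hyperbolic_params_def)
  show "\<forall>(\<alpha>, b)\<in>U. \<exists>C. attracting_cycle (f \<alpha> b) C \<and> half_limit n (\<alpha>, b) \<in> C \<inter> I_minus"
  proof clarify
    fix \<alpha> b assume q: "(\<alpha>, b) \<in> U"
    obtain a where a: "\<alpha> = to_circle a" by (rule to_circle_exhaust)
    obtain \<theta> where "tongue a b n \<theta>" using n q a by blast
    then obtain v where v: "doubling_period n \<theta>" "1/2 < ret a b n \<theta> (1/2)" "1/2 < v" "v \<le> 1"
      "ret a b n \<theta> v < v" by (rule tongueE)
    obtain x C where "1/2 < x" "x < v" "half_limit n (to_circle a, b) = to_circle x"
      "attracting_cycle (f (to_circle a) b) C" "to_circle x \<in> C"
      using half_limit_between[OF _ _ v(1,2) order_refl less_imp_le[OF v(3)] v(3,2,5)] b_range[OF q]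
      by blast
    then show "\<exists>C. attracting_cycle (f \<alpha> b) C \<and> half_limit n (\<alpha>, b) \<in> C \<inter> I_minus"
      using a v(4) by (intro exI[of _ C]) (auto simp: I_minus_def)
  qed
  show "continuous_on U (half_limit n)"
    unfolding continuous_on_def
  proof
    fix q assume q: "q \<in> U"
    obtain \<alpha> b where "q = (\<alpha>, b)" by (cases q)
    moreover obtain a where "\<alpha> = to_circle a" by (rule to_circle_exhaust)
    ultimately have q_eq: "q = (to_circle a, b)" by simp
    have b: "0 \<le> b" "b < 1" using b_range q q_eq by blast+
    obtain \<theta> where t: "tongue a b n \<theta>" using n q q_eq by blast
    then obtain v where v: "doubling_period n \<theta>" "1/2 < ret a b n \<theta> (1/2)" "1/2 < v" "v \<le> 1"
      "ret a b n \<theta> v < v" by (rule tongueE)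
    obtain x where x: "1/2 < x" "x < v" "ret a b n \<theta> x = x"
      and above: "\<And>z. 1/2 \<le> z \<Longrightarrow> z < x \<Longrightarrow> z < ret a b n \<theta> z"
      and below: "\<And>z. x < z \<Longrightarrow> z \<le> v \<Longrightarrow> ret a b n \<theta> z < z"
      using unique_crossing[OF b v(1,2,5,3)] by blast
    obtain y C where y: "1/2 < y" "y < v" "ret a b n \<theta> y = y" "half_limit n (to_circle a, b) = to_circle y"
      using half_limit_between[OF b v(1,2) order_refl less_imp_le[OF v(3)] v(3,2,5)] by blast
    have "x = y" using above[of y] below[of y] y by linarith
    have "\<forall>\<^sub>F q' in nhds (to_circle a, b). dist (half_limit n q') (to_circle x) < e" if "e > 0" for e
    proof (rule eventually_nhds_lift)
      define d where "d = min (e / 2) (min (x - 1/2) (v - x))"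
      have d: "0 < d" "d < e" "1/2 \<le> x - d" "x + d \<le> v" using \<open>e > 0\<close> x by (auto simp: d_def min_def)
      have lim: "((\<lambda>q. ret (fst q) (snd q) n \<theta> z - z) \<longlongrightarrow> ret a b n \<theta> z - z) (nhds (a, b))" for z
        by (intro tendsto_intros tendsto_ret_param)
      have "\<forall>\<^sub>F q' in nhds (a, b). 0 < ret (fst q') (snd q') n \<theta> (x - d) - (x - d)"
        using order_tendstoD(1)[OF lim, of 0] above[of "x - d"] d by simp
      moreover have "\<forall>\<^sub>F q' in nhds (a, b). ret (fst q') (snd q') n \<theta> (x + d) - (x + d) < 0"
        using order_tendstoD(2)[OF lim, of "x + d" 0] below[of "x + d"] d by simp
      moreover note eventually_tongue_strip[OF b t]
      ultimately show "\<forall>\<^sub>F q' in nhds (a, b). dist (half_limit n (to_circle (fst q'), snd q')) (to_circle x) < e"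
      proof eventually_elim
        case (elim q')
        then have "\<exists>z C. 1/2 < z \<and> x - d \<le> z \<and> z < x + d \<and> ret (fst q') (snd q') n \<theta> z = z \<and>
          half_limit n (to_circle (fst q'), snd q') = to_circle z \<and>
          attracting_cycle (f (to_circle (fst q')) (snd q')) C \<and> to_circle z \<in> C"
          using d x by (intro half_limit_between) (auto simp: tongue_def)
        then obtain z where z: "x - d \<le> z" "z < x + d" "half_limit n (to_circle (fst q'), snd q') = to_circle z"
          by blast
        then have "\<bar>z - x\<bar> < e" using d by auto
        then show ?case using dist_to_circle_le[of z x] z(3) by simp
      qed
    qed
    then have "(half_limit n \<longlongrightarrow> to_circle x) (nhds q)" unfolding q_eq tendsto_iff by blast
    then show "(half_limit n \<longlongrightarrow> half_limit n q) (at q within U)"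
      using y(4) \<open>x = y\<close> q_eq filterlim_mono[OF _ order_refl at_within_le_nhds] by simp
  qed
qed

text \<open>
  A single parameter slightly to the right of \<open>(a, b)\<close> provides \<open>\<theta>\<close> and \<open>v\<close>. Lowering \<open>a\<close> lowers the
  return map, so \<open>v\<close> is still moved to the left; if the step to the right is small, the image of
  \<open>1/2\<close> cannot jump across \<open>1/2\<close> modulo 1.
\<close>

lemma left_boundary_tangency:
  assumes U: "U \<in> components hyperbolic_params"
    and n: "\<And>a b. (to_circle a, b) \<in> U \<Longrightarrow> \<exists>\<theta>. tongue a b n \<theta>"
    and q: "(to_circle a, b) \<in> left_boundary U"
  obtains \<theta> v where "0 \<le> b" "b < 1" "doubling_period n \<theta>" "ret a b n \<theta> (1/2) = 1/2"
    "1/2 < v" "v \<le> 1" "ret a b n \<theta> v < v"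
proof -
  define w where "w = (F a b ^^ n) (1/2)"
  (* m + 1/2 is the largest integer translate of 1/2 that is not above the n-th image of 1/2. *)
  define m where "m = \<lfloor>w - 1/2\<rfloor>"
  have "((\<lambda>t. (a + t, b)) \<longlongrightarrow> (a + 0, b)) (at_right 0)" by (intro tendsto_intros)
  then have "((\<lambda>t. (F (a + t) b ^^ n) (1/2)) \<longlongrightarrow> w) (at_right 0)"
    using filterlim_compose[OF tendsto_F_iterate_param[of n "1/2" a b], of "\<lambda>t. (a + t, b)"]
    by (simp add: w_def)
  moreover have "w < of_int m + 3/2" unfolding m_def by linarith
  ultimately have "\<forall>\<^sub>F t in at_right 0. (F (a + t) b ^^ n) (1/2) < of_int m + 3/2"
    by (rule order_tendstoD(2))
  moreover have "\<forall>\<^sub>F t in at_right 0. (to_circle a + to_circle t, b) \<in> U"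
    using q by (simp add: left_boundary_def)
  moreover have "\<forall>\<^sub>F t in at_right 0. 0 < (t::real)" by (rule eventually_at_right_less)
  ultimately have "\<forall>\<^sub>F t in at_right 0. (F (a + t) b ^^ n) (1/2) < of_int m + 3/2 \<and>
    (to_circle a + to_circle t, b) \<in> U \<and> 0 < t" by eventually_elim simp
  then obtain t where t: "(F (a + t) b ^^ n) (1/2) < of_int m + 3/2" "(to_circle (a + t), b) \<in> U" "0 < t"
    using eventually_happens[of _ "at_right (0::real)"] by (auto simp: plus_circle.abs_eq)
  have b: "0 \<le> b" "b < 1" using in_components_subset[OF U] t(2) by (auto simp: hyperbolic_params_def)
  obtain \<theta> where "tongue (a + t) b n \<theta>" using n t(2) by blast
  then obtain v where v: "doubling_period n \<theta>" "1/2 < ret (a + t) b n \<theta> (1/2)" "1/2 < v" "v \<le> 1"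
    "ret (a + t) b n \<theta> v < v" by (rule tongueE)
  obtain j where j: "(2 ^ n - 1) * \<theta> = of_int j" using doubling_periodD(2)[OF v(1)] by (elim Ints_cases)
  have "of_int j < (of_int (m + 1) :: real)" using v(2) t(1) by (simp add: ret_def j)
  then have "j \<le> m" by linarith
  then have "of_int j \<le> w - 1/2" unfolding m_def by linarith
  then have ge: "1/2 \<le> ret a b n \<theta> (1/2)" by (simp add: ret_def j w_def)
  have less: "ret a b n \<theta> v < v"
    using F_iterate_param_mono[OF b, of a "a + t" n v] v(5) t(3) by (simp add: ret_def)
  have "\<not> 1/2 < ret a b n \<theta> (1/2)"
  proof
    assume "1/2 < ret a b n \<theta> (1/2)"
    then have "tongue a b n \<theta>" using v less by (auto simp: tongue_def)
    then have "(to_circle a, b) \<in> hyperbolic_params" using hyperbolic_if_tongue[OF b] by blast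
    with frontier_not_hyperbolic[OF U] q show False by (auto simp: left_boundary_def)
  qed
  with ge have "ret a b n \<theta> (1/2) = 1/2" by simp
  with b v less show ?thesis using that by blast
qed

lemma below_diagonal_after_tangency:
  assumes b: "0 \<le> b" "b < 1" and per: "doubling_period n \<theta>"
    and "ret a b n \<theta> (1/2) = 1/2" "ret a b n \<theta> v < v" "1/2 < z" "z < v"
  shows "ret a b n \<theta> z < z"
  using ret_convex_from_half_trapped[OF b per, of a v] convex_on_less_diagonal[of "1/2" v _ z] assms(4-)
  by auto

text \<open>
  At parameters of the component close to \<open>q\<close> the image of \<open>1/2\<close> under the return map belonging to \<open>q\<close>
  is close to \<open>1/2\<close>, and that under their own return map lies in \<open>(1/2, 1)\<close>. The two differ by an
  integer, so they agree. Thus the point \<open>x\<close>, which is still moved to the left, bounds the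
  attracting point from above.
\<close>

lemma half_limit_left_boundary:
  assumes U: "U \<in> components hyperbolic_params"
    and n: "\<And>a b. (to_circle a, b) \<in> U \<Longrightarrow> \<exists>\<theta>. tongue a b n \<theta>"
    and q: "q \<in> left_boundary U"
  shows "(half_limit n \<longlongrightarrow> to_circle (1/2)) (at q within U)"
  unfolding tendsto_iff eventually_at_filter
proof (intro allI impI)
  fix e :: real assume "e > 0"
  obtain \<alpha> b where "q = (\<alpha>, b)" by (cases q)
  moreover obtain a where "\<alpha> = to_circle a" by (rule to_circle_exhaust)
  ultimately have q_eq: "q = (to_circle a, b)" by simp
  obtain \<theta> v where b: "0 \<le> b" "b < 1" and per: "doubling_period n \<theta>" and half: "ret a b n \<theta> (1/2) = 1/2"
    and v: "1/2 < v" "v \<le> 1" "ret a b n \<theta> v < v"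
    using left_boundary_tangency[OF U n q[unfolded q_eq]] by blast
  define d where "d = min e (v - 1/2)"
  have d: "0 < d" "d \<le> e" "d \<le> v - 1/2" using \<open>e > 0\<close> v by (simp_all add: d_def)
  define x where "x = 1/2 + d / 2"
  have x: "1/2 < x" "x < v" "x < 1/2 + e" using d by (simp_all add: x_def)
  have lim: "((\<lambda>q. ret (fst q) (snd q) n \<theta> x - x) \<longlongrightarrow> ret a b n \<theta> x - x) (nhds (a, b))"
    by (intro tendsto_intros tendsto_ret_param)
  have "ret a b n \<theta> x - x < 0"
    using below_diagonal_after_tangency[OF b per half v(3) x(1,2)] by simp
  then have "\<forall>\<^sub>F q' in nhds (a, b). ret (fst q') (snd q') n \<theta> x - x < 0"
    by (rule order_tendstoD(2)[OF lim])
  moreover have "\<forall>\<^sub>F q' in nhds (a, b). 0 < ret (fst q') (snd q') n \<theta> (1/2)"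
    using order_tendstoD(1)[OF tendsto_ret_param, of 0] half by simp
  moreover have "\<forall>\<^sub>F q' in nhds (a, b). ret (fst q') (snd q') n \<theta> (1/2) < 1"
    using order_tendstoD(2)[OF tendsto_ret_param, of _ _ _ _ _ 1] half by simp
  ultimately have "\<forall>\<^sub>F q' in nhds (a, b). (to_circle (fst q'), snd q') \<in> U \<longrightarrow>
    dist (half_limit n (to_circle (fst q'), snd q')) (to_circle (1/2)) < e"
  proof eventually_elim
    case (elim q')
    let ?G = "ret (fst q') (snd q') n"
    show ?case
    proof
      assume q'_U: "(to_circle (fst q'), snd q') \<in> U"
      then have b': "0 \<le> snd q'" "snd q' < 1"
        using in_components_subset[OF U] by (auto simp: hyperbolic_params_def)
      obtain \<eta> where "tongue (fst q') (snd q') n \<eta>" using n q'_U by blast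
      then obtain v' where v': "doubling_period n \<eta>" "1/2 < ?G \<eta> (1/2)" "1/2 < v'" "v' \<le> 1" "?G \<eta> v' < v'"
        by (rule tongueE)
      obtain x' where x': "1/2 < x'" "x' < v'" "?G \<eta> x' = x'"
        and "\<And>z. 1/2 \<le> z \<Longrightarrow> z < x' \<Longrightarrow> z < ?G \<eta> z"
        and "\<And>z. x' < z \<Longrightarrow> z \<le> v' \<Longrightarrow> ?G \<eta> z < z"
        using unique_crossing[OF b' v'(1,2,5,3)] by blast
      have "?G \<eta> (1/2) < ?G \<eta> x'"
        using ret_strict_mono[OF b'] x'(1) by (simp add: strict_mono_less)
      then have "?G \<eta> (1/2) < 1" using x' v'(4) by simp
      obtain j where j: "(2 ^ n - 1) * \<theta> = of_int j"
        using doubling_periodD(2)[OF per] by (elim Ints_cases)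
      obtain k where "(2 ^ n - 1) * \<eta> = of_int k"
        using doubling_periodD(2)[OF v'(1)] by (elim Ints_cases)
      note jk = j this
      have "?G \<theta> (1/2) - ?G \<eta> (1/2) = of_int (k - j)" by (simp add: ret_def jk)
      moreover have "\<bar>?G \<theta> (1/2) - ?G \<eta> (1/2)\<bar> < 1" using elim v'(2) \<open>?G \<eta> (1/2) < 1\<close> by auto
      ultimately have "k = j" by linarith
      then have "?G \<eta> z = ?G \<theta> z" for z by (simp add: ret_def jk)
      then have "?G \<eta> x < x" using elim by simp
      then obtain z where z: "1/2 < z" "z < x" "half_limit n (to_circle (fst q'), snd q') = to_circle z"
        using half_limit_between[OF b' v'(1,2) order_refl less_imp_le[OF x(1)] x(1) v'(2)] by blast
      then have "\<bar>z - 1/2\<bar> < e" using x by simp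
      with z(3) show "dist (half_limit n (to_circle (fst q'), snd q')) (to_circle (1/2)) < e"
        using dist_to_circle_le[of z "1/2"] by simp
    qed
  qed
  then have "\<forall>\<^sub>F q' in nhds q. q' \<in> U \<longrightarrow> dist (half_limit n q') (to_circle (1/2)) < e"
    unfolding q_eq by (rule eventually_nhds_lift[where
        P = "\<lambda>q. q \<in> U \<longrightarrow> dist (half_limit n q) (to_circle (1/2)) < e"])
  then show "\<forall>\<^sub>F q' in nhds q. q' \<noteq> q \<longrightarrow> q' \<in> U \<longrightarrow> dist (half_limit n q') (to_circle (1/2)) < e"
    by eventually_elim simp
qed

text \<open>
  The points just to the right of \<open>1/2\<close> are moved to the left but not beyond \<open>1/2\<close>, hence never leave
  a neighbourhood of \<open>1/2\<close>. An attracting point \<open>1/2\<close> would make the frontier parameter hyperbolic.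
\<close>

lemma neutral_left_boundary:
  assumes U: "U \<in> components hyperbolic_params" and q: "(\<alpha>, b) \<in> left_boundary U"
  shows "neutral_periodic_point (f \<alpha> b) (to_circle (1/2))"
proof -
  obtain n where "\<forall>a b. (to_circle a, b) \<in> U \<longrightarrow> (\<exists>\<theta>. tongue a b n \<theta>)"
    using component_period[OF U] ..
  then have n: "\<And>a b. (to_circle a, b) \<in> U \<Longrightarrow> \<exists>\<theta>. tongue a b n \<theta>" by blast
  obtain a where a: "\<alpha> = to_circle a" by (rule to_circle_exhaust)
  let ?g = "f (to_circle a) b"
  obtain \<theta> v where b: "0 \<le> b" "b < 1" and per: "doubling_period n \<theta>" and half: "ret a b n \<theta> (1/2) = 1/2"
    and v: "1/2 < v" "v \<le> 1" "ret a b n \<theta> v < v"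
    using left_boundary_tangency[OF U n q[unfolded a]] by blast
  have period: "has_period ?g n (to_circle (1/2))" using has_period_if_ret_fixed[OF b per half] .
  moreover have "\<not> attracting_fixed_point (?g ^^ n) (to_circle (1/2))"
  proof
    assume "attracting_fixed_point (?g ^^ n) (to_circle (1/2))"
    from attracting_cycle_orbit[OF continuous_f period this]
    have "(to_circle a, b) \<in> hyperbolic_params" using b by (auto simp: hyperbolic_params_def)
    with frontier_not_hyperbolic[OF U] q a show False by (auto simp: left_boundary_def)
  qed
  moreover have "\<not> repelling_fixed_point (?g ^^ n) (to_circle (1/2))"
  proof
    assume "repelling_fixed_point (?g ^^ n) (to_circle (1/2))"
    then obtain V where V: "open V" "to_circle (1/2) \<in> V"
      and leaves: "\<And>c. c \<in> V - {to_circle (1/2)} \<Longrightarrow> \<exists>k. ((?g ^^ n) ^^ k) c \<notin> V"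
      unfolding repelling_fixed_point_def by blast
    have "open (to_circle -` V)" "1/2 \<in> to_circle -` V" using V open_circle_iff[of V] by simp_all
    then obtain e where e: "e > 0" "ball (1/2) e \<subseteq> to_circle -` V" by (rule openE)
    define d where "d = min e (v - 1/2)"
    have d: "0 < d" "d \<le> e" "d \<le> v - 1/2" using e(1) v by (simp_all add: d_def)
    define x where "x = 1/2 + d / 2"
    have x: "1/2 < x" "x < v" "x < 1/2 + e" using d by (simp_all add: x_def)
    have inV: "to_circle z \<in> V" if "1/2 \<le> z" "z \<le> x" for z
      using subsetD[OF e(2), of z] that x by (simp add: dist_real_def)
    have x_less: "ret a b n \<theta> x < x" using below_diagonal_after_tangency[OF b per half v(3) x(1,2)] .
    have mono: "mono (ret a b n \<theta>)" using strict_mono_mono[OF ret_strict_mono[OF b]] .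
    have trapped: "1/2 \<le> (ret a b n \<theta> ^^ k) x \<and> (ret a b n \<theta> ^^ k) x \<le> x" for k
    proof (induction k)
      case (Suc k)
      then show ?case
        using monoD[OF mono, of "1/2" "(ret a b n \<theta> ^^ k) x"] monoD[OF mono, of "(ret a b n \<theta> ^^ k) x" x]
          half x_less by simp
    qed (use x in simp)
    have "((?g ^^ n) ^^ k) (to_circle x) = to_circle ((ret a b n \<theta> ^^ k) x)" for k
      by (rule iterate_to_circle) (rule to_circle_ret[OF doubling_periodD(2)[OF per]])
    then have "((?g ^^ n) ^^ k) (to_circle x) \<in> V" for k using inV trapped by simp
    moreover have "to_circle x \<noteq> to_circle (1/2)"
    proof
      assume "to_circle x = to_circle (1/2)"
      then obtain j where "x - 1/2 = of_int j" by (auto simp: to_circle_eq_iff elim: Ints_cases)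
      moreover have "0 < x - 1/2" "x - 1/2 < 1" using x v by auto
      ultimately have "0 < real_of_int j" "real_of_int j < 1" by simp_all
      then show False by simp
    qed
    ultimately show False using leaves[of "to_circle x"] inV[of x] x by auto
  qed
  ultimately show ?thesis unfolding neutral_periodic_point_def a by blast
qed

section \<open>The reflection exchanging left and right\<close>

definition reflect :: "circle \<Rightarrow> circle"
  where "reflect c = to_circle (1/2) - c"

text \<open>
  The parameter \<open>1/2 - a\<close> is the same point of the circle as \<open>- a - 1/2\<close>, which is what conjugating by
  \<open>reflect\<close> produces.
\<close>

definition reflect_param :: "circle \<times> real \<Rightarrow> circle \<times> real"
  where "reflect_param q = (to_circle (1/2) - fst q, snd q)"

lemma to_circle_diff: "to_circle x - to_circle y = to_circle (x - y)"
  by (simp add: minus_circle.abs_eq)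

lemma reflect_to_circle: "reflect (to_circle x) = to_circle (1/2 - x)"
  by (simp add: reflect_def to_circle_diff)

lemma reflect_reflect [simp]: "reflect (reflect c) = c"
  by (simp add: reflect_def)

lemma reflect_param_reflect_param [simp]: "reflect_param (reflect_param q) = q"
  by (simp add: reflect_param_def)

lemma dist_circle_diff: "dist (c - x) (c - y) = dist x (y :: circle)"
proof -
  obtain u where u: "c = to_circle u" by (rule to_circle_exhaust)
  obtain v where v: "x = to_circle v" by (rule to_circle_exhaust)
  obtain w where w: "y = to_circle w" by (rule to_circle_exhaust)
  have "dist_Ints (w - v) = dist_Ints (v - w)"
    using dist_commute[of "to_circle v" "to_circle w"] by (simp add: dist_to_circle)
  then show ?thesis by (simp add: u v w to_circle_diff dist_to_circle)
qed

lemma dist_reflect [simp]: "dist (reflect x) (reflect y) = dist x y"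
  by (simp add: reflect_def dist_circle_diff)

lemma dist_reflect_param [simp]: "dist (reflect_param x) (reflect_param y) = dist x y"
  by (cases x; cases y) (simp add: reflect_param_def dist_Pair_Pair dist_circle_diff)

lemma S_reflect: "S (1/2 - x) = - S x"
proof -
  define j where "j = \<lfloor>x\<rfloor>"
  have j: "of_int j \<le> x" "x < of_int j + 1" unfolding j_def by linarith+
  have "S x = 1 - 4 * \<bar>x - (of_int j + 1/2)\<bar>"
    using j by (intro S_concave_form) auto
  moreover have "S (1/2 - x) = 4 * \<bar>1/2 - x - of_int (- j)\<bar> - 1"
    using j by (intro S_convex_form) (auto simp: abs_if)
  moreover have "\<bar>1/2 - x - of_int (- j)\<bar> = \<bar>x - (of_int j + 1/2)\<bar>" by simp
  ultimately show ?thesis by simp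
qed

text \<open>
  The function \<open>S\<close> is odd about \<open>1/4\<close>, and \<open>1/4\<close> is the fixed point of \<open>x \<mapsto> 1/2 - x\<close>.
\<close>

lemma f_reflect: "f (to_circle (1/2) - \<alpha>) b (reflect c) = reflect (f \<alpha> b c)"
proof -
  obtain a where a: "\<alpha> = to_circle a" by (rule to_circle_exhaust)
  obtain x where x: "c = to_circle x" by (rule to_circle_exhaust)
  have "F (1/2 - a) b (1/2 - x) - (1/2 - F a b x) = 1"
    by (simp add: F_def S_reflect algebra_simps)
  then show ?thesis
    by (simp add: a x to_circle_diff reflect_to_circle f_to_circle to_circle_eq_iff)
qed

lemma open_involution_image:
  fixes s :: "'a::metric_space \<Rightarrow> 'a"
  assumes inv: "\<And>x. s (s x) = x" and iso: "\<And>x y. dist (s x) (s y) = dist x y" and "open V"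
  shows "open (s ` V)"
  unfolding open_dist
proof
  fix y assume "y \<in> s ` V"
  then obtain x where x: "x \<in> V" "y = s x" by blast
  then obtain e where e: "e > 0" "\<And>z. dist z x < e \<Longrightarrow> z \<in> V"
    using \<open>open V\<close> unfolding open_dist by blast
  have "z \<in> s ` V" if "dist z y < e" for z
  proof -
    have "dist (s z) x = dist z y" using iso[of z y] by (simp add: inv x)
    then have "s z \<in> V" using e(2) that by simp
    then show ?thesis using imageI[of "s z" V s] by (simp add: inv)
  qed
  with e(1) show "\<exists>e>0. \<forall>z. dist z y < e \<longrightarrow> z \<in> s ` V" by blast
qed

lemma attracting_fixed_point_conjugate:
  fixes s :: "'a::metric_space \<Rightarrow> 'a"
  assumes inv: "\<And>x. s (s x) = x" and iso: "\<And>x y. dist (s x) (s y) = dist x y"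
    and conj: "\<And>x. g' (s x) = s (g x)" and attr: "attracting_fixed_point g x"
  shows "attracting_fixed_point g' (s x)"
proof -
  obtain V where V: "open V" "x \<in> V" and fp: "g x = x"
    and unif: "uniform_limit V (\<lambda>k. g ^^ k) (\<lambda>_. x) sequentially"
    using attr unfolding attracting_fixed_point_def by blast
  have iter: "(g' ^^ k) (s y) = s ((g ^^ k) y)" for k y by (induction k) (simp_all add: conj)
  have unif': "uniform_limit (s ` V) (\<lambda>k. g' ^^ k) (\<lambda>_. s x) sequentially"
    using unif unfolding uniform_limit_iff by (simp add: iter iso)
  show ?thesis
    unfolding attracting_fixed_point_def
  proof (intro conjI exI)
    show "g' (s x) = s x" using conj[of x] fp by simp
    show "open (s ` V)" using inv iso V(1) by (rule open_involution_image)
    show "s x \<in> s ` V" using V(2) by (rule imageI)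
  qed (rule unif')
qed

lemma repelling_fixed_point_conjugate:
  fixes s :: "'a::metric_space \<Rightarrow> 'a"
  assumes inv: "\<And>x. s (s x) = x" and iso: "\<And>x y. dist (s x) (s y) = dist x y"
    and conj: "\<And>x. g' (s x) = s (g x)" and rep: "repelling_fixed_point g x"
  shows "repelling_fixed_point g' (s x)"
proof -
  obtain V where V: "open V" "x \<in> V" and fp: "g x = x"
    and leaves: "\<forall>y\<in>V - {x}. \<exists>k. (g ^^ k) y \<notin> V"
    using rep unfolding repelling_fixed_point_def by blast
  have iter: "(g' ^^ k) (s y) = s ((g ^^ k) y)" for k y by (induction k) (simp_all add: conj)
  have "inj s" using inv by (metis injI)
  then have mem: "s y \<in> s ` V \<longleftrightarrow> y \<in> V" for y by (rule inj_image_mem_iff)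
  have moves: "\<exists>k. (g' ^^ k) y \<notin> s ` V" if y: "y \<in> s ` V - {s x}" for y
  proof -
    obtain z where z: "z \<in> V" "y = s z" using y by blast
    then have "z \<in> V - {x}" using y by auto
    then obtain k where "(g ^^ k) z \<notin> V" using leaves by blast
    then have "(g' ^^ k) y \<notin> s ` V" by (simp add: z iter mem)
    then show ?thesis ..
  qed
  show ?thesis
    unfolding repelling_fixed_point_def
  proof (intro conjI exI)
    show "g' (s x) = s x" using conj[of x] fp by simp
    show "open (s ` V)" using inv iso V(1) by (rule open_involution_image)
    show "s x \<in> s ` V" using V(2) by (rule imageI)
    show "\<forall>y\<in>s ` V - {s x}. \<exists>k. (g' ^^ k) y \<notin> s ` V" using moves by blast
  qed
qed

lemma has_period_conjugate:
  assumes inv: "\<And>x. s (s x) = x" and conj: "\<And>x. g' (s x) = s (g x)" and per: "has_period g n x"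
  shows "has_period g' n (s x)"
proof -
  have iter: "(g' ^^ k) (s y) = s ((g ^^ k) y)" for k y by (induction k) (simp_all add: conj)
  have "s y = s z \<longleftrightarrow> y = z" for y z by (metis inv)
  then show ?thesis using per by (simp add: has_period_def iter)
qed

lemma f_iterate_reflect:
  "(f (to_circle (1/2) - \<alpha>) b ^^ n) (reflect c) = reflect ((f \<alpha> b ^^ n) c)"
  by (induction n) (simp_all add: f_reflect)

lemma attracting_cycle_reflect:
  assumes "attracting_cycle (f \<alpha> b) C"
  shows "attracting_cycle (f (to_circle (1/2) - \<alpha>) b) (reflect ` C)"
proof -
  let ?g = "f (to_circle (1/2) - \<alpha>) b"
  obtain n x where x: "has_period (f \<alpha> b) n x" "C = (\<lambda>i. (f \<alpha> b ^^ i) x) ` {..<n}"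
    and attr: "\<And>y. y \<in> C \<Longrightarrow> attracting_fixed_point (f \<alpha> b ^^ n) y"
    using assms unfolding attracting_cycle_def by blast
  have "has_period ?g n (reflect x)"
    by (rule has_period_conjugate[where g = "f \<alpha> b"]) (simp_all add: f_reflect x(1))
  moreover have "reflect ` C = (\<lambda>i. (?g ^^ i) (reflect x)) ` {..<n}"
    by (simp add: x(2) image_image f_iterate_reflect)
  moreover have "attracting_fixed_point (?g ^^ n) (reflect y)" if "y \<in> C" for y
    by (rule attracting_fixed_point_conjugate[where g = "f \<alpha> b ^^ n"])
      (simp_all add: f_iterate_reflect attr that)
  ultimately show ?thesis unfolding attracting_cycle_def by blast
qed

lemma neutral_reflect:
  assumes "neutral_periodic_point (f (to_circle (1/2) - \<alpha>) b) c"
  shows "neutral_periodic_point (f \<alpha> b) (reflect c)"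
proof -
  let ?g = "f (to_circle (1/2) - \<alpha>) b"
  have conj: "f \<alpha> b (reflect y) = reflect (?g y)" for y
    using f_reflect[of "to_circle (1/2) - \<alpha>" b y] by simp
  have conj_iter: "(f \<alpha> b ^^ n) (reflect y) = reflect ((?g ^^ n) y)" for n y
    by (induction n) (simp_all add: conj)
  obtain n where n: "has_period ?g n c" "\<not> attracting_fixed_point (?g ^^ n) c"
    "\<not> repelling_fixed_point (?g ^^ n) c"
    using assms unfolding neutral_periodic_point_def by blast
  have "has_period (f \<alpha> b) n (reflect c)"
    by (rule has_period_conjugate[where g = ?g]) (simp_all add: conj n(1))
  moreover have "attracting_fixed_point (?g ^^ n) c" if "attracting_fixed_point (f \<alpha> b ^^ n) (reflect c)"
    using attracting_fixed_point_conjugate[OF reflect_reflect dist_reflect f_iterate_reflect that] by simp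
  moreover have "repelling_fixed_point (?g ^^ n) c" if "repelling_fixed_point (f \<alpha> b ^^ n) (reflect c)"
    using repelling_fixed_point_conjugate[OF reflect_reflect dist_reflect f_iterate_reflect that] by simp
  ultimately show ?thesis using n unfolding neutral_periodic_point_def by blast
qed

lemma reflect_I_minus: "c \<in> I_minus \<Longrightarrow> reflect c \<in> I_minus"
proof -
  assume "c \<in> I_minus"
  then obtain x where x: "c = to_circle x" "1/2 \<le> x" "x \<le> 1" by (auto simp: I_minus_def)
  have "to_circle (1/2 - x) = to_circle (3/2 - x)" by (simp add: to_circle_eq_iff)
  then show ?thesis using x by (auto simp: I_minus_def reflect_to_circle intro!: image_eqI[of _ _ "3/2 - x"])
qed

lemma reflect_param_hyperbolic:
  assumes "q \<in> hyperbolic_params" shows "reflect_param q \<in> hyperbolic_params"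
proof -
  obtain \<alpha> b where q: "q = (\<alpha>, b)" by (cases q)
  then obtain C where "0 \<le> b" "b < 1" and C: "attracting_cycle (f \<alpha> b) C"
    using assms by (auto simp: hyperbolic_params_def)
  with attracting_cycle_reflect[OF C] show ?thesis
    by (auto simp: q hyperbolic_params_def reflect_param_def)
qed

lemma continuous_reflect: "continuous_on A reflect"
proof -
  have "1-lipschitz_on A reflect" by (simp add: lipschitz_on_def)
  then show ?thesis by (rule lipschitz_on_continuous_on)
qed

lemma continuous_reflect_param: "continuous_on A reflect_param"
proof -
  have "1-lipschitz_on A reflect_param" by (simp add: lipschitz_on_def)
  then show ?thesis by (rule lipschitz_on_continuous_on)
qed

lemma mem_reflect_param_image: "q \<in> reflect_param ` U \<longleftrightarrow> reflect_param q \<in> U"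
proof -
  have "inj reflect_param" using reflect_param_reflect_param by (metis injI)
  then have "reflect_param (reflect_param q) \<in> reflect_param ` U \<longleftrightarrow> reflect_param q \<in> U"
    by (rule inj_image_mem_iff)
  then show ?thesis by simp
qed

lemma reflect_param_image_image: "reflect_param ` reflect_param ` U = U"
  by (simp add: image_image)

lemma reflect_param_component:
  assumes U: "U \<in> components hyperbolic_params"
  shows "reflect_param ` U \<in> components hyperbolic_params"
  unfolding in_components_maximal
proof (intro conjI allI impI)
  have U': "U \<noteq> {} \<and> U \<subseteq> hyperbolic_params \<and> connected U \<and>
      (\<forall>D. D \<noteq> {} \<and> U \<subseteq> D \<and> D \<subseteq> hyperbolic_params \<and> connected D \<longrightarrow> D = U)"
    using U unfolding in_components_maximal .
  have sub: "reflect_param ` D \<subseteq> hyperbolic_params" if "D \<subseteq> hyperbolic_params" for D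
    using that by (intro image_subsetI reflect_param_hyperbolic) (rule subsetD)
  have conn: "connected (reflect_param ` D)" if "connected D" for D
    using continuous_reflect_param that by (rule connected_continuous_image)
  show "reflect_param ` U \<noteq> {}" using U' by simp
  show "reflect_param ` U \<subseteq> hyperbolic_params" using U' by (intro sub) simp
  show "connected (reflect_param ` U)" using U' by (intro conn) simp
  fix D assume D: "D \<noteq> {} \<and> reflect_param ` U \<subseteq> D \<and> D \<subseteq> hyperbolic_params \<and> connected D"
  have "reflect_param ` D = U"
  proof (rule U'[THEN conjunct2, THEN conjunct2, THEN conjunct2, rule_format], intro conjI)
    show "reflect_param ` D \<noteq> {}" using D by simp
    have "reflect_param ` reflect_param ` U \<subseteq> reflect_param ` D" using D by (intro image_mono) simp
    then show "U \<subseteq> reflect_param ` D" unfolding reflect_param_image_image .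
    show "reflect_param ` D \<subseteq> hyperbolic_params" using D by (intro sub) simp
    show "connected (reflect_param ` D)" using D by (intro conn) simp
  qed
  then have "reflect_param ` reflect_param ` D = reflect_param ` U" by simp
  then show "D = reflect_param ` U" unfolding reflect_param_image_image .
qed

lemma reflect_param_right_boundary:
  assumes "q \<in> right_boundary U" shows "reflect_param q \<in> left_boundary (reflect_param ` U)"
proof -
  obtain \<alpha> b where q: "q = (\<alpha>, b)" by (cases q)
  have fr: "q \<in> frontier U" and ev: "\<forall>\<^sub>F t in at_right 0. (\<alpha> - to_circle t, b) \<in> U"
    using assms by (auto simp: right_boundary_def q)
  have "reflect_param q \<in> frontier (reflect_param ` U)"
    unfolding frontier_straddle
  proof (intro allI impI)
    fix e :: real assume "0 < e"
    then obtain y z where yz: "y \<in> U" "dist q y < e" "z \<notin> U" "dist q z < e"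
      using fr unfolding frontier_straddle by blast
    have "reflect_param y \<in> reflect_param ` U" "reflect_param z \<notin> reflect_param ` U"
      using yz by (simp_all add: mem_reflect_param_image)
    moreover have "dist (reflect_param q) (reflect_param y) < e" "dist (reflect_param q) (reflect_param z) < e"
      using yz by simp_all
    ultimately show "(\<exists>x\<in>reflect_param ` U. dist (reflect_param q) x < e) \<and>
        (\<exists>x. x \<notin> reflect_param ` U \<and> dist (reflect_param q) x < e)"
      by blast
  qed
  moreover have "\<forall>\<^sub>F t in at_right 0. (to_circle (1/2) - \<alpha> + to_circle t, b) \<in> reflect_param ` U"
    using ev unfolding mem_reflect_param_image
    by eventually_elim (simp add: reflect_param_def algebra_simps)
  ultimately show ?thesis by (simp add: q left_boundary_def reflect_param_def)
qed

lemma attracting_branch_reflect: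
  assumes "attracting_branch (reflect_param ` U) p"
  shows "attracting_branch U (\<lambda>q. reflect (p (reflect_param q)))"
  unfolding attracting_branch_def
proof
  have "continuous_on (reflect_param ` U) p" using assms by (simp add: attracting_branch_def)
  then show "continuous_on U (\<lambda>q. reflect (p (reflect_param q)))"
    by (intro continuous_on_compose2[OF continuous_reflect[of UNIV]]
        continuous_on_compose2[OF _ continuous_reflect_param]) auto
  show "\<forall>(\<alpha>, b)\<in>U. \<exists>C. attracting_cycle (f \<alpha> b) C \<and> reflect (p (reflect_param (\<alpha>, b))) \<in> C \<inter> I_minus"
  proof clarify
    fix \<alpha> b assume "(\<alpha>, b) \<in> U"
    then have "(to_circle (1/2) - \<alpha>, b) \<in> reflect_param ` U"
      unfolding mem_reflect_param_image by (simp add: reflect_param_def)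
    then obtain C where C: "attracting_cycle (f (to_circle (1/2) - \<alpha>) b) C"
      "p (to_circle (1/2) - \<alpha>, b) \<in> C \<inter> I_minus"
      using assms unfolding attracting_branch_def by blast
    have "attracting_cycle (f \<alpha> b) (reflect ` C)" using attracting_cycle_reflect[OF C(1)] by simp
    moreover have "reflect (p (reflect_param (\<alpha>, b))) \<in> reflect ` C \<inter> I_minus"
      using C(2) reflect_I_minus[of "p (to_circle (1/2) - \<alpha>, b)"] by (simp add: reflect_param_def)
    ultimately show "\<exists>C. attracting_cycle (f \<alpha> b) C \<and> reflect (p (reflect_param (\<alpha>, b))) \<in> C \<inter> I_minus"
      by blast
  qed
qed

lemma tendsto_reflect:
  assumes "(p \<longlongrightarrow> c) (at (reflect_param q) within reflect_param ` U)"
  shows "((\<lambda>q. reflect (p (reflect_param q))) \<longlongrightarrow> reflect c) (at q within U)"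
  unfolding tendsto_iff eventually_at
proof (intro allI impI)
  fix e :: real assume "0 < e"
  then obtain d where d: "d > 0" "\<forall>x\<in>reflect_param ` U.
      x \<noteq> reflect_param q \<and> dist x (reflect_param q) < d \<longrightarrow> dist (p x) c < e"
    using assms unfolding tendsto_iff eventually_at by blast
  have "dist (reflect (p (reflect_param x))) (reflect c) < e" if x: "x \<in> U" "x \<noteq> q" "dist x q < d" for x
  proof -
    have "reflect_param x \<noteq> reflect_param q" using x(2) by (metis reflect_param_reflect_param)
    then show ?thesis using d(2) x by simp
  qed
  with d(1) show "\<exists>d>0. \<forall>x\<in>U. x \<noteq> q \<and> dist x q < d \<longrightarrow> dist (reflect (p (reflect_param x))) (reflect c) < e"
    by blast
qed

section \<open>Both boundaries\<close>

lemma left_boundary_branch: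
  assumes U: "U \<in> components hyperbolic_params"
  shows "\<exists>p. attracting_branch U p \<and> (\<forall>q\<in>left_boundary U. (p \<longlongrightarrow> to_circle (1/2)) (at q within U))"
proof -
  obtain n where "\<forall>a b. (to_circle a, b) \<in> U \<longrightarrow> (\<exists>\<theta>. tongue a b n \<theta>)"
    using component_period[OF U] ..
  then have n: "\<And>a b. (to_circle a, b) \<in> U \<Longrightarrow> \<exists>\<theta>. tongue a b n \<theta>" by blast
  show ?thesis
  proof (intro exI[of _ "half_limit n"] conjI ballI)
    show "attracting_branch U (half_limit n)" using U n by (rule attracting_branch_half_limit)
    show "(half_limit n \<longlongrightarrow> to_circle (1/2)) (at q within U)" if "q \<in> left_boundary U" for q
      using U n that by (rule half_limit_left_boundary)
  qed
qed

lemma reflect_half: "reflect (to_circle (1/2)) = to_circle 0"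
  by (simp add: reflect_to_circle)

theorem proposition7p1:
  fixes U :: "(circle \<times> real) set"
  assumes "U \<in> components hyperbolic_params"
  shows "(\<exists>p. attracting_branch U p \<and>
            (\<forall>q\<in>left_boundary U. (p \<longlongrightarrow> to_circle (1/2)) (at q within U))) \<and>
         (\<exists>p. attracting_branch U p \<and>
            (\<forall>q\<in>right_boundary U. (p \<longlongrightarrow> to_circle 0) (at q within U))) \<and>
         (\<forall>(a, b)\<in>right_boundary U. neutral_periodic_point (f a b) (to_circle 0)) \<and>
         (\<forall>(a, b)\<in>left_boundary U. neutral_periodic_point (f a b) (to_circle (1/2)))"
proof (intro conjI)
  let ?U' = "reflect_param ` U"
  have U': "?U' \<in> components hyperbolic_params" using assms by (rule reflect_param_component)
  show "\<exists>p. attracting_branch U p \<and>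
      (\<forall>q\<in>left_boundary U. (p \<longlongrightarrow> to_circle (1/2)) (at q within U))"
    using assms by (rule left_boundary_branch)
  obtain p where p: "attracting_branch ?U' p"
    "\<forall>q\<in>left_boundary ?U'. (p \<longlongrightarrow> to_circle (1/2)) (at q within ?U')"
    using left_boundary_branch[OF U'] by blast
  show "\<exists>p. attracting_branch U p \<and>
      (\<forall>q\<in>right_boundary U. (p \<longlongrightarrow> to_circle 0) (at q within U))"
  proof (intro exI conjI ballI)
    show "attracting_branch U (\<lambda>q. reflect (p (reflect_param q)))"
      using p(1) by (rule attracting_branch_reflect)
    fix q assume "q \<in> right_boundary U"
    then have "reflect_param q \<in> left_boundary ?U'" by (rule reflect_param_right_boundary)
    then have "(p \<longlongrightarrow> to_circle (1/2)) (at (reflect_param q) within ?U')" using p(2) by blast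
    then show "((\<lambda>q. reflect (p (reflect_param q))) \<longlongrightarrow> to_circle 0) (at q within U)"
      unfolding reflect_half[symmetric] by (rule tendsto_reflect)
  qed
  show "\<forall>(a, b)\<in>right_boundary U. neutral_periodic_point (f a b) (to_circle 0)"
  proof clarify
    fix \<alpha> b assume "(\<alpha>, b) \<in> right_boundary U"
    then have "reflect_param (\<alpha>, b) \<in> left_boundary ?U'" by (rule reflect_param_right_boundary)
    then have "(to_circle (1/2) - \<alpha>, b) \<in> left_boundary ?U'" by (simp add: reflect_param_def)
    then have "neutral_periodic_point (f (to_circle (1/2) - \<alpha>) b) (to_circle (1/2))"
      by (rule neutral_left_boundary[OF U'])
    then show "neutral_periodic_point (f \<alpha> b) (to_circle 0)"
      unfolding reflect_half[symmetric] by (rule neutral_reflect)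
  qed
  show "\<forall>(a, b)\<in>left_boundary U. neutral_periodic_point (f a b) (to_circle (1/2))"
    using neutral_left_boundary[OF assms] by auto
qed

end
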